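(* For any two consistent theories $T$ and $T^*$ in the language of set theory, each extending ZFC, there exist a set $W$ and binary relations $\in$ and $\in^*$ on $W$ such that $\langle W,\in\rangle\models T$, $\langle W,\in^*\rangle\models T^*$, and the induced inclusion relations coincide: for all $u,v\in W$, $\forall a\,(a\in u\to a\in v)\iff\forall a\,(a\in^* u\to a\in^* v)$. *)

theory Defs
  imports Main
begin

section \<open>First-order formulas in the language of set theory\<close>

text \<open>Variables are de Bruijn indices: under \<open>FAll\<close>, index \<open>0\<close> is the bound variable and
  index \<open>Suc k\<close> is the outer variable \<open>k\<close>. The language has no function symbols, so variables are
  the only terms and substitution is renaming.\<close>

datatype fm =
    Mem nat nat  (infix \<open>\<^bold>\<in>\<close> 60)
  | Eql nat nat  (infix \<open>\<^bold>=\<close> 60)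
  | Fls          (\<open>\<^bold>\<bottom>\<close>)
  | Imp fm fm    (infixr \<open>\<^bold>\<longrightarrow>\<close> 45)
  | FAll fm

abbreviation Neg :: "fm \<Rightarrow> fm"  (\<open>\<^bold>\<not> _\<close> [58] 58)
  where "\<^bold>\<not> p \<equiv> p \<^bold>\<longrightarrow> \<^bold>\<bottom>"

abbreviation Con :: "fm \<Rightarrow> fm \<Rightarrow> fm"  (infixr \<open>\<^bold>\<and>\<close> 55)
  where "p \<^bold>\<and> q \<equiv> \<^bold>\<not> (p \<^bold>\<longrightarrow> \<^bold>\<not> q)"

abbreviation Dis :: "fm \<Rightarrow> fm \<Rightarrow> fm"  (infixr \<open>\<^bold>\<or>\<close> 50)
  where "p \<^bold>\<or> q \<equiv> \<^bold>\<not> p \<^bold>\<longrightarrow> q"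

abbreviation Iff :: "fm \<Rightarrow> fm \<Rightarrow> fm"  (infix \<open>\<^bold>\<longleftrightarrow>\<close> 40)
  where "p \<^bold>\<longleftrightarrow> q \<equiv> (p \<^bold>\<longrightarrow> q) \<^bold>\<and> (q \<^bold>\<longrightarrow> p)"

primrec ren :: "(nat \<Rightarrow> nat) \<Rightarrow> fm \<Rightarrow> fm" where
  "ren f (i \<^bold>\<in> j) = (f i \<^bold>\<in> f j)"
| "ren f (i \<^bold>= j) = (f i \<^bold>= f j)"
| "ren f \<^bold>\<bottom> = \<^bold>\<bottom>"
| "ren f (p \<^bold>\<longrightarrow> q) = (ren f p \<^bold>\<longrightarrow> ren f q)"
| "ren f (FAll p) = FAll (ren (case_nat 0 (\<lambda>k. Suc (f k))) p)"

primrec fv :: "fm \<Rightarrow> nat set" where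
  "fv (i \<^bold>\<in> j) = {i, j}"
| "fv (i \<^bold>= j) = {i, j}"
| "fv \<^bold>\<bottom> = {}"
| "fv (p \<^bold>\<longrightarrow> q) = fv p \<union> fv q"
| "fv (FAll p) = {k. Suc k \<in> fv p}"

definition sentence :: "fm \<Rightarrow> bool"
  where "sentence p \<longleftrightarrow> fv p = {}"

definition is_theory :: "fm set \<Rightarrow> bool"
  where "is_theory T \<longleftrightarrow> (\<forall>p\<in>T. sentence p)"

text \<open>The body \<open>p\<close> of \<open>FAll p\<close> with its bound variable replaced by \<open>k\<close>.\<close>

definition inst :: "nat \<Rightarrow> fm \<Rightarrow> fm"
  where "inst k p = ren (case_nat k (\<lambda>i. i)) p"


section \<open>Derivability and consistency\<close>

text \<open>Classical natural deduction with equality. In \<open>AllI\<close> the shift of \<open>\<Gamma>\<close> is the eigenvariable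
  condition.\<close>

inductive derives :: "fm set \<Rightarrow> fm \<Rightarrow> bool"  (infix \<open>\<turnstile>\<close> 30) where
  Assm: "p \<in> \<Gamma> \<Longrightarrow> \<Gamma> \<turnstile> p"
| ImpI: "insert p \<Gamma> \<turnstile> q \<Longrightarrow> \<Gamma> \<turnstile> p \<^bold>\<longrightarrow> q"
| ImpE: "\<Gamma> \<turnstile> p \<^bold>\<longrightarrow> q \<Longrightarrow> \<Gamma> \<turnstile> p \<Longrightarrow> \<Gamma> \<turnstile> q"
| Clas: "insert (\<^bold>\<not> p) \<Gamma> \<turnstile> \<^bold>\<bottom> \<Longrightarrow> \<Gamma> \<turnstile> p"
| AllI: "ren Suc ` \<Gamma> \<turnstile> p \<Longrightarrow> \<Gamma> \<turnstile> FAll p"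
| AllE: "\<Gamma> \<turnstile> FAll p \<Longrightarrow> \<Gamma> \<turnstile> inst k p"
| EqlI: "\<Gamma> \<turnstile> k \<^bold>= k"
| EqlE: "\<Gamma> \<turnstile> i \<^bold>= j \<Longrightarrow> \<Gamma> \<turnstile> inst i p \<Longrightarrow> \<Gamma> \<turnstile> inst j p"

definition consistent :: "fm set \<Rightarrow> bool"
  where "consistent T \<longleftrightarrow> \<not> (T \<turnstile> \<^bold>\<bottom>)"

definition extends :: "fm set \<Rightarrow> fm set \<Rightarrow> bool"
  where "extends T S \<longleftrightarrow> (\<forall>p. sentence p \<longrightarrow> (S \<turnstile> p) \<longrightarrow> (T \<turnstile> p))"


section \<open>Models\<close>

primrec sat :: "'a set \<Rightarrow> 'a rel \<Rightarrow> (nat \<Rightarrow> 'a) \<Rightarrow> fm \<Rightarrow> bool" where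
  "sat W E v (i \<^bold>\<in> j) \<longleftrightarrow> (v i, v j) \<in> E"
| "sat W E v (i \<^bold>= j) \<longleftrightarrow> v i = v j"
| "sat W E v \<^bold>\<bottom> \<longleftrightarrow> False"
| "sat W E v (p \<^bold>\<longrightarrow> q) \<longleftrightarrow> (sat W E v p \<longrightarrow> sat W E v q)"
| "sat W E v (FAll p) \<longleftrightarrow> (\<forall>a\<in>W. sat W E (case_nat a v) p)"

definition models :: "'a set \<Rightarrow> 'a rel \<Rightarrow> fm set \<Rightarrow> bool"
  where "models W E T \<longleftrightarrow>
    W \<noteq> {} \<and> (\<forall>p\<in>T. \<forall>v. range v \<subseteq> W \<longrightarrow> sat W E v p)"


section \<open>The axioms of ZFC\<close>

text \<open>Quantification over a named variable \<open>x\<close>: bind \<open>x\<close> and shift all other variables. The lemmas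
  \<open>sat_QAll\<close> and \<open>sat_QEx\<close> below confirm that this is the usual named quantifier.\<close>

definition QAll :: "nat \<Rightarrow> fm \<Rightarrow> fm"  (\<open>(\<^bold>\<forall>_./ _)\<close> [1000, 35] 35)
  where "(\<^bold>\<forall>x. p) = FAll (ren (\<lambda>k. if k = x then 0 else Suc k) p)"

abbreviation QEx :: "nat \<Rightarrow> fm \<Rightarrow> fm"  (\<open>(\<^bold>\<exists>_./ _)\<close> [1000, 35] 35)
  where "(\<^bold>\<exists>x. p) \<equiv> \<^bold>\<not> (\<^bold>\<forall>x. \<^bold>\<not> p)"

lemma sat_ren: "sat W E v (ren f p) \<longleftrightarrow> sat W E (\<lambda>k. v (f k)) p"
proof (induction p arbitrary: f v)
  case (FAll p)
  have "(\<lambda>k. case_nat a v (case_nat 0 (\<lambda>k. Suc (f k)) k)) = case_nat a (\<lambda>k. v (f k))" for a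
    by (rule ext) (simp split: nat.split)
  then show ?case by (simp add: FAll)
qed auto

lemma sat_QAll: "sat W E v (\<^bold>\<forall>x. p) \<longleftrightarrow> (\<forall>a\<in>W. sat W E (v(x := a)) p)"
proof -
  have "(\<lambda>k. case_nat a v (if k = x then 0 else Suc k)) = v(x := a)" for a
    by (rule ext) simp
  then show ?thesis by (simp add: QAll_def sat_ren)
qed

lemma sat_QEx: "sat W E v (\<^bold>\<exists>x. p) \<longleftrightarrow> (\<exists>a\<in>W. sat W E (v(x := a)) p)"
  by (simp add: sat_QAll)

definition Extensionality :: fm where
  "Extensionality = (let x = 0; y = 1; z = 2 in
    \<^bold>\<forall>x. \<^bold>\<forall>y. (\<^bold>\<forall>z. (z \<^bold>\<in> x \<^bold>\<longleftrightarrow> z \<^bold>\<in> y)) \<^bold>\<longrightarrow> x \<^bold>= y)"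

definition Foundation :: fm where
  "Foundation = (let x = 0; y = 1; z = 2 in
    \<^bold>\<forall>x. (\<^bold>\<exists>y. y \<^bold>\<in> x) \<^bold>\<longrightarrow> (\<^bold>\<exists>y. (y \<^bold>\<in> x \<^bold>\<and> \<^bold>\<not> (\<^bold>\<exists>z. (z \<^bold>\<in> x \<^bold>\<and> z \<^bold>\<in> y)))))"

definition Pairing :: fm where
  "Pairing = (let x = 0; y = 1; z = 2; w = 3 in
    \<^bold>\<forall>x. \<^bold>\<forall>y. \<^bold>\<exists>z. \<^bold>\<forall>w. (w \<^bold>\<in> z \<^bold>\<longleftrightarrow> (w \<^bold>= x \<^bold>\<or> w \<^bold>= y)))"

definition Unions :: fm where
  "Unions = (let x = 0; y = 1; z = 2; u = 3 in
    \<^bold>\<forall>x. \<^bold>\<exists>u. \<^bold>\<forall>z. (z \<^bold>\<in> u \<^bold>\<longleftrightarrow> (\<^bold>\<exists>y. (y \<^bold>\<in> x \<^bold>\<and> z \<^bold>\<in> y))))"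

definition Powerset :: fm where
  "Powerset = (let x = 0; y = 1; z = 2; w = 3 in
    \<^bold>\<forall>x. \<^bold>\<exists>y. \<^bold>\<forall>z. (z \<^bold>\<in> y \<^bold>\<longleftrightarrow> (\<^bold>\<forall>w. (w \<^bold>\<in> z \<^bold>\<longrightarrow> w \<^bold>\<in> x))))"

definition Infinity :: fm where
  "Infinity = (let x = 0; y = 1; z = 2; s = 3 in
    \<^bold>\<exists>x. ((\<^bold>\<exists>y. (y \<^bold>\<in> x \<^bold>\<and> (\<^bold>\<forall>z. \<^bold>\<not> z \<^bold>\<in> y))) \<^bold>\<and>
         (\<^bold>\<forall>y. (y \<^bold>\<in> x \<^bold>\<longrightarrow> (\<^bold>\<exists>s. (s \<^bold>\<in> x \<^bold>\<and> (\<^bold>\<forall>z. (z \<^bold>\<in> s \<^bold>\<longleftrightarrow> (z \<^bold>\<in> y \<^bold>\<or> z \<^bold>= y)))))))))"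

text \<open>Every family of nonempty pairwise disjoint sets has a transversal.\<close>

definition Choice :: fm where
  "Choice = (let f = 0; x = 1; y = 2; z = 3; c = 4 in
    \<^bold>\<forall>f. ((\<^bold>\<forall>x. (x \<^bold>\<in> f \<^bold>\<longrightarrow> (\<^bold>\<exists>z. z \<^bold>\<in> x))) \<^bold>\<and>
         (\<^bold>\<forall>x. \<^bold>\<forall>y. (x \<^bold>\<in> f \<^bold>\<and> y \<^bold>\<in> f \<^bold>\<and> (\<^bold>\<exists>z. (z \<^bold>\<in> x \<^bold>\<and> z \<^bold>\<in> y)) \<^bold>\<longrightarrow> x \<^bold>= y))) \<^bold>\<longrightarrow>
       (\<^bold>\<exists>c. \<^bold>\<forall>x. (x \<^bold>\<in> f \<^bold>\<longrightarrow> (\<^bold>\<exists>y. \<^bold>\<forall>z. (z \<^bold>\<in> x \<^bold>\<and> z \<^bold>\<in> c \<^bold>\<longleftrightarrow> z \<^bold>= y)))))"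

text \<open>In the two schemes, \<open>\<phi>\<close> may contain the displayed variables except the excluded ones, and
  arbitrary further variables as parameters; the parameters are then universally quantified, each
  \<open>FAll\<close> in the prefix binding one de Bruijn index.\<close>

definition Separation_scheme :: "fm set" where
  "Separation_scheme = (let x = 0; a = 1; b = 2 in
    {p. \<exists>n \<phi>. b \<notin> fv \<phi> \<and> sentence p \<and>
      p = (FAll ^^ n) (\<^bold>\<forall>a. \<^bold>\<exists>b. \<^bold>\<forall>x. (x \<^bold>\<in> b \<^bold>\<longleftrightarrow> (x \<^bold>\<in> a \<^bold>\<and> \<phi>)))})"

definition Replacement_scheme :: "fm set" where
  "Replacement_scheme = (let x = 0; y = 1; a = 2; b = 3; z = 4 in
    {p. \<exists>n \<phi>. b \<notin> fv \<phi> \<and> z \<notin> fv \<phi> \<and> sentence p \<and>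
      p = (FAll ^^ n)
        (\<^bold>\<forall>a. (\<^bold>\<forall>x. (x \<^bold>\<in> a \<^bold>\<longrightarrow> (\<^bold>\<exists>z. \<^bold>\<forall>y. (\<phi> \<^bold>\<longleftrightarrow> y \<^bold>= z)))) \<^bold>\<longrightarrow>
             (\<^bold>\<exists>b. \<^bold>\<forall>y. (y \<^bold>\<in> b \<^bold>\<longleftrightarrow> (\<^bold>\<exists>x. (x \<^bold>\<in> a \<^bold>\<and> \<phi>)))))})"

definition ZFC :: "fm set" where
  "ZFC = {Extensionality, Foundation, Pairing, Unions, Powerset, Infinity, Choice}
    \<union> Separation_scheme \<union> Replacement_scheme"

end

theory Submission
  imports Defs "HOL-Library.Countable_Set"
begin

text \<open>
  In a model of set theory the sets of members of its elements form a field of subsets of the domain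
  that contains all finite sets but not the domain itself. Suppose that every infinite member of the
  field splits into two infinite members and that every member is disjoint from some infinite member.
  A back-and-forth argument, matching the cells of finite partitions by their number of points and by
  whether they belong to the field, then shows that any two such countable fields are isomorphic with
  respect to inclusion. The two splitting conditions say that certain types are realised. They are
  finitely satisfiable by the axioms of extensionality, pairing, union and separation, so that a
  Henkin construction with variables as witnesses can realise them in a countable model of any
  consistent extension of ZFC. Transporting the second membership relation along the isomorphism puts
  both models on the same domain.
\<close>

section \<open>Renaming and derivability\<close>

lemma ren_ren: "ren f (ren g p) = ren (\<lambda>k. f (g k)) p"
proof (induction p arbitrary: f g)
  case (FAll p)
  have "(\<lambda>k. case_nat 0 (\<lambda>k. Suc (f k)) (case_nat 0 (\<lambda>k. Suc (g k)) k))
      = case_nat 0 (\<lambda>k. Suc (f (g k)))"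
    by (rule ext) (simp split: nat.split)
  then show ?case by (simp add: FAll)
qed auto

lemma ren_cong: "(\<And>k. k \<in> fv p \<Longrightarrow> f k = g k) \<Longrightarrow> ren f p = ren g p"
proof (induction p arbitrary: f g)
  case (FAll p)
  have "case_nat 0 (\<lambda>k. Suc (f k)) k = case_nat 0 (\<lambda>k. Suc (g k)) k" if "k \<in> fv p" for k
    using that FAll.prems by (cases k) auto
  then show ?case using FAll.IH by (metis ren.simps(5))
next
  case (Imp p q)
  then show ?case by (metis Un_iff fv.simps(4) ren.simps(4))
qed auto

lemma ren_ident: "ren (\<lambda>k. k) p = p"
proof (induction p)
  case (FAll p)
  have "case_nat 0 Suc = (\<lambda>k. k)" by (rule ext) (simp split: nat.split)
  then show ?case using FAll by simp
qed auto

lemma fv_ren: "fv (ren f p) = f ` fv p"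
proof (induction p arbitrary: f)
  case (FAll p)
  show ?case
  proof (intro set_eqI iffI)
    fix k assume "k \<in> fv (ren f (FAll p))"
    then obtain j where "j \<in> fv p" "Suc k = case_nat 0 (\<lambda>k. Suc (f k)) j"
      by (auto simp: FAll)
    then show "k \<in> f ` fv (FAll p)" by (cases j) auto
  next
    fix k assume "k \<in> f ` fv (FAll p)"
    then obtain j where "Suc j \<in> fv p" "k = f j" by auto
    then have "Suc k = case_nat 0 (\<lambda>k. Suc (f k)) (Suc j)" "Suc j \<in> fv p" by auto
    then show "k \<in> fv (ren f (FAll p))" by (auto simp: FAll simp del: nat.case)
  qed
qed auto

text \<open>Instantiating after a renaming lifted under a binder amounts to one renaming. This is
  why the later induction over formulas can be carried out for all renamings at once.\<close>

lemma inst_ren: "inst k (ren (case_nat 0 (\<lambda>k. Suc (f k))) p) = ren (case_nat k f) p"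
proof -
  have "(\<lambda>j. case_nat k (\<lambda>i. i) (case_nat 0 (\<lambda>k. Suc (f k)) j)) = case_nat k f"
    by (rule ext) (simp split: nat.split)
  then show ?thesis by (simp add: inst_def ren_ren)
qed

lemma ren_inst: "ren f (inst k p) = inst (f k) (ren (case_nat 0 (\<lambda>k. Suc (f k))) p)"
proof -
  have "(\<lambda>j. f (case_nat k (\<lambda>i. i) j)) = case_nat (f k) f"
    by (rule ext) (simp split: nat.split)
  then show ?thesis unfolding inst_ren by (simp add: inst_def ren_ren)
qed

lemma derives_mono: "\<Gamma> \<turnstile> p \<Longrightarrow> \<Gamma> \<subseteq> \<Delta> \<Longrightarrow> \<Delta> \<turnstile> p"
proof (induction arbitrary: \<Delta> rule: derives.induct)
  case (ImpI p \<Gamma> q)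
  then show ?case by (meson derives.ImpI insert_mono)
next
  case (Clas p \<Gamma>)
  then show ?case by (meson derives.Clas insert_mono)
next
  case (AllI \<Gamma> p)
  then show ?case by (meson derives.AllI image_mono)
qed (blast intro: derives.intros)+

text \<open>The compactness of derivability. Where a rule discharges an assumption, that formula is
  removed from the finite set again; for \<open>AllI\<close> the finite set is pulled back along
  \<open>ren Suc\<close>.\<close>

lemma derives_finite: "\<Gamma> \<turnstile> p \<Longrightarrow> \<exists>\<Delta>. finite \<Delta> \<and> \<Delta> \<subseteq> \<Gamma> \<and> (\<Delta> \<turnstile> p)"
proof (induction rule: derives.induct)
  case (Assm p \<Gamma>)
  then show ?case by (intro exI[of _ "{p}"]) (auto intro: derives.Assm)
next
  case (ImpI p \<Gamma> q)
  then obtain \<Delta> where "finite \<Delta>" "\<Delta> \<subseteq> insert p \<Gamma>" "\<Delta> \<turnstile> q" by blast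
  moreover from this have "insert p (\<Delta> - {p}) \<turnstile> q" by (auto elim: derives_mono)
  ultimately show ?case by (intro exI[of _ "\<Delta> - {p}"]) (auto intro: derives.ImpI)
next
  case (ImpE \<Gamma> p q)
  then obtain \<Delta> \<Delta>' where "finite \<Delta>" "\<Delta> \<subseteq> \<Gamma>" "\<Delta> \<turnstile> p \<^bold>\<longrightarrow> q" "finite \<Delta>'" "\<Delta>' \<subseteq> \<Gamma>" "\<Delta>' \<turnstile> p"
    by blast
  then show ?case
    by (intro exI[of _ "\<Delta> \<union> \<Delta>'"]) (meson Un_least derives.ImpE derives_mono finite_UnI sup_ge1 sup_ge2)
next
  case (Clas p \<Gamma>)
  then obtain \<Delta> where "finite \<Delta>" "\<Delta> \<subseteq> insert (\<^bold>\<not> p) \<Gamma>" "\<Delta> \<turnstile> \<^bold>\<bottom>" by blast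
  moreover from this have "insert (\<^bold>\<not> p) (\<Delta> - {\<^bold>\<not> p}) \<turnstile> \<^bold>\<bottom>" by (auto elim: derives_mono)
  ultimately show ?case by (intro exI[of _ "\<Delta> - {\<^bold>\<not> p}"]) (auto intro: derives.Clas)
next
  case (AllI \<Gamma> p)
  then obtain \<Delta> where "finite \<Delta>" "\<Delta> \<subseteq> ren Suc ` \<Gamma>" "\<Delta> \<turnstile> p" by blast
  then show ?case by (metis derives.AllI finite_subset_image)
next
  case (EqlE \<Gamma> i j p)
  then obtain \<Delta> \<Delta>' where "finite \<Delta>" "\<Delta> \<subseteq> \<Gamma>" "\<Delta> \<turnstile> i \<^bold>= j"
      "finite \<Delta>'" "\<Delta>' \<subseteq> \<Gamma>" "\<Delta>' \<turnstile> inst i p"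
    by blast
  then show ?case
    by (intro exI[of _ "\<Delta> \<union> \<Delta>'"]) (meson Un_least derives.EqlE derives_mono finite_UnI sup_ge1 sup_ge2)
qed (blast intro: derives.intros)+

lemma derives_ren: "\<Gamma> \<turnstile> p \<Longrightarrow> ren f ` \<Gamma> \<turnstile> ren f p"
proof (induction arbitrary: f rule: derives.induct)
  case (AllI \<Gamma> p)
  have "ren (case_nat 0 (\<lambda>k. Suc (f k))) ` ren Suc ` \<Gamma> = ren Suc ` ren f ` \<Gamma>"
    by (simp add: image_image ren_ren)
  then show ?case using AllI.IH[of "case_nat 0 (\<lambda>k. Suc (f k))"] by (simp add: derives.AllI)
next
  case (AllE \<Gamma> p k)
  then show ?case by (simp add: ren_inst derives.AllE)
next
  case (EqlE \<Gamma> i j p)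
  then show ?case by (metis derives.EqlE ren.simps(2) ren_inst)
qed (auto intro: derives.intros)

text \<open>The eigenvariable rule for a fresh index \<open>k\<close>. The renaming
  \<open>?f\<close> sends \<open>k\<close> to 0 and shifts all else, so by freshness it agrees with
  \<open>Suc\<close> on \<open>\<Gamma>\<close> and undoes the instantiation of
  \<open>p\<close>.\<close>

lemma derives_generalize:
  assumes "\<Gamma> \<turnstile> inst k p" and "k \<notin> (\<Union>q\<in>\<Gamma>. fv q)" and "k \<notin> fv (FAll p)"
  shows "\<Gamma> \<turnstile> FAll p"
proof -
  let ?f = "\<lambda>i. if i = k then 0 else Suc i"
  have "ren ?f ` \<Gamma> = ren Suc ` \<Gamma>"
    using assms(2) by (intro image_cong refl ren_cong) auto
  moreover have "ren ?f (inst k p) = ren (\<lambda>k. k) p"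
    unfolding inst_def ren_ren using assms(3)
    by (intro ren_cong) (auto split: nat.split)
  ultimately show ?thesis
    using derives_ren[OF assms(1), of ?f] by (auto simp: ren_ident intro: derives.AllI)
qed

section \<open>Soundness and consistency\<close>

lemma derives_sound:
  "\<Gamma> \<turnstile> p \<Longrightarrow> range v \<subseteq> W \<Longrightarrow> \<forall>q\<in>\<Gamma>. sat W E v q \<Longrightarrow> sat W E v p"
proof (induction arbitrary: v rule: derives.induct)
  case (AllI \<Gamma> p)
  have "sat W E (case_nat a v) p" if "a \<in> W" for a
  proof (rule AllI.IH)
    show "range (case_nat a v) \<subseteq> W" using that AllI.prems(1) by (force split: nat.split)
    show "\<forall>q\<in>ren Suc ` \<Gamma>. sat W E (case_nat a v) q"
      using AllI.prems(2) by (simp add: sat_ren)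
  qed
  then show ?case by simp
next
  case (AllE \<Gamma> p k)
  have "(\<lambda>j. v (case_nat k (\<lambda>i. i) j)) = case_nat (v k) v"
    by (rule ext) (simp split: nat.split)
  moreover have "v k \<in> W" using AllE.prems(1) by auto
  ultimately show ?case using AllE.IH[OF AllE.prems] by (simp add: inst_def sat_ren)
next
  case (EqlE \<Gamma> i j p)
  have *: "(\<lambda>j. v (case_nat k (\<lambda>i. i) j)) = case_nat (v k) v" for k
    by (rule ext) (simp split: nat.split)
  show ?case using EqlE.IH[OF EqlE.prems] by (simp add: inst_def sat_ren *)
qed auto

lemma sat_cong: "(\<And>k. k \<in> fv p \<Longrightarrow> v k = w k) \<Longrightarrow> sat W E v p \<longleftrightarrow> sat W E w p"
proof (induction p arbitrary: v w)
  case (FAll p)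
  have "sat W E (case_nat a v) p \<longleftrightarrow> sat W E (case_nat a w) p" for a
    using FAll.prems by (intro FAll.IH) (auto split: nat.split)
  then show ?case by simp
next
  case (Imp p q)
  then show ?case by (metis Un_iff fv.simps(4) sat.simps(4))
qed auto

lemma consistent_if_sat:
  "range v \<subseteq> W \<Longrightarrow> \<forall>q\<in>\<Gamma>. sat W E v q \<Longrightarrow> consistent \<Gamma>"
  unfolding consistent_def using derives_sound by (metis sat.simps(3))

lemma consistent_insert_or:
  assumes "consistent \<Gamma>"
  shows "consistent (insert p \<Gamma>) \<or> consistent (insert (\<^bold>\<not> p) \<Gamma>)"
  using assms unfolding consistent_def by (metis derives.Clas derives.ImpE derives.ImpI)

text \<open>A derivation of a contradiction uses finitely many formulas, and these already occur
  together at one stage of the chain.\<close>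

lemma consistent_Union_chain:
  fixes S :: "nat \<Rightarrow> fm set"
  assumes "mono S" and "\<And>n. consistent (S n)"
  shows "consistent (\<Union>n. S n)"
proof (rule ccontr)
  assume "\<not> ?thesis"
  then obtain \<Delta> where "finite \<Delta>" "\<Delta> \<subseteq> (\<Union>n. S n)" "\<Delta> \<turnstile> \<^bold>\<bottom>"
    unfolding consistent_def using derives_finite by blast
  moreover from this(1,2) have "\<exists>n. \<Delta> \<subseteq> S n"
  proof (induction \<Delta>)
    case (insert p \<Delta>)
    then obtain m n where "p \<in> S m" "\<Delta> \<subseteq> S n" by blast
    then have "insert p \<Delta> \<subseteq> S (max m n)"
      using monoD[OF assms(1), of m "max m n"] monoD[OF assms(1), of n "max m n"] by auto
    then show ?case ..
  qed simp
  ultimately show False using assms(2) derives_mono unfolding consistent_def by blast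
qed


section \<open>Henkin models\<close>

instance fm :: countable
  by countable_datatype

abbreviation Fv :: "fm set \<Rightarrow> nat set"
  where "Fv \<Gamma> \<equiv> \<Union>q\<in>\<Gamma>. fv q"

lemma finite_fv: "finite (fv p)"
proof (induction p)
  case (FAll p)
  have "fv (FAll p) = Suc -` fv p" by auto
  then show ?case using FAll by (metis finite_vimageI inj_Suc)
qed auto

text \<open>Rejecting a universal formula includes naming a counterexample, so that a single
  enumeration of all formulas yields both maximality and Henkin witnesses.\<close>

definition decides :: "fm set \<Rightarrow> fm \<Rightarrow> bool" where
  "decides \<Gamma> p \<longleftrightarrow>
    p \<in> \<Gamma> \<or> (\<^bold>\<not> p \<in> \<Gamma> \<and> (\<forall>q. p = FAll q \<longrightarrow> (\<exists>k. \<^bold>\<not> inst k q \<in> \<Gamma>)))"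

lemma decides_mono: "decides \<Gamma> p \<Longrightarrow> \<Gamma> \<subseteq> \<Delta> \<Longrightarrow> decides \<Delta> p"
  unfolding decides_def by blast

text \<open>Only the free variables of \<open>\<Gamma>\<close> have to be finite in number, not its
  formulas. This supplies a fresh witness \<open>k\<close> and still allows whole types to be added
  at a stage. If the counterexample at \<open>k\<close> were refutable, generalising over
  \<open>k\<close> would prove the rejected universal formula.\<close>

lemma henkin_step:
  assumes "consistent \<Gamma>" and "finite (Fv \<Gamma>)"
  shows "\<exists>\<Delta>. \<Gamma> \<subseteq> \<Delta> \<and> consistent \<Delta> \<and> finite (Fv \<Delta>) \<and> decides \<Delta> p"
proof (cases "consistent (insert p \<Gamma>)")
  case True
  then show ?thesis using assms(2) by (intro exI[of _ "insert p \<Gamma>"]) (auto simp: finite_fv decides_def)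
next
  case False
  then have con: "consistent (insert (\<^bold>\<not> p) \<Gamma>)" using consistent_insert_or[OF assms(1)] by blast
  show ?thesis
  proof (cases "\<exists>q. p = FAll q")
    case False
    then show ?thesis using con assms(2)
      by (intro exI[of _ "insert (\<^bold>\<not> p) \<Gamma>"]) (auto simp: finite_fv decides_def)
  next
    case True
    then obtain q where p: "p = FAll q" ..
    have "finite (Fv (insert (\<^bold>\<not> p) \<Gamma>))" using assms(2) by (auto simp: finite_fv)
    then obtain k where k: "k \<notin> Fv (insert (\<^bold>\<not> p) \<Gamma>)" using ex_new_if_finite by blast
    let ?\<Delta> = "insert (\<^bold>\<not> inst k q) (insert (\<^bold>\<not> p) \<Gamma>)"
    have "consistent ?\<Delta>"
    proof (rule ccontr)
      assume "\<not> consistent ?\<Delta>"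
      then have "insert (\<^bold>\<not> p) \<Gamma> \<turnstile> inst k q" unfolding consistent_def by (blast intro: derives.Clas)
      then have "insert (\<^bold>\<not> p) \<Gamma> \<turnstile> p" using k derives_generalize by (auto simp: p)
      then show False using con unfolding consistent_def by (metis derives.Assm derives.ImpE insertI1)
    qed
    moreover have "finite (Fv ?\<Delta>)" using assms(2) by (simp add: finite_fv del: fv.simps(5))
    ultimately show ?thesis using p by (intro exI[of _ ?\<Delta>]) (auto simp: decides_def)
  qed
qed

section \<open>The term model of a Henkin set\<close>

locale henkin_set =
  fixes H :: "fm set"
  assumes con: "consistent H"
    and max: "p \<in> H \<or> \<^bold>\<not> p \<in> H"
    and witness: "FAll p \<in> H \<or> (\<exists>k. \<^bold>\<not> inst k p \<in> H)"
begin

lemma derives_iff: "H \<turnstile> p \<longleftrightarrow> p \<in> H"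
  using con max unfolding consistent_def by (metis derives.Assm derives.ImpE)

lemma Fls_iff: "\<^bold>\<bottom> \<notin> H"
  using con derives_iff unfolding consistent_def by blast

lemma Imp_iff: "(p \<^bold>\<longrightarrow> q) \<in> H \<longleftrightarrow> (p \<in> H \<longrightarrow> q \<in> H)"
proof
  show "(p \<^bold>\<longrightarrow> q) \<in> H \<Longrightarrow> p \<in> H \<longrightarrow> q \<in> H" using derives.ImpE derives_iff by blast
next
  assume *: "p \<in> H \<longrightarrow> q \<in> H"
  have "insert p H \<turnstile> q"
  proof (cases "p \<in> H")
    case True
    then show ?thesis using * by (auto intro: derives.Assm)
  next
    case False
    then have "insert p H \<turnstile> \<^bold>\<bottom>" using max by (metis derives.Assm derives.ImpE insertCI)
    then show ?thesis by (blast intro: derives.Clas derives_mono)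
  qed
  then show "(p \<^bold>\<longrightarrow> q) \<in> H" using derives.ImpI derives_iff by blast
qed

lemma FAll_iff: "FAll p \<in> H \<longleftrightarrow> (\<forall>k. inst k p \<in> H)"
  using witness derives.AllE derives_iff Imp_iff Fls_iff by metis

lemma Eql_refl: "(i \<^bold>= i) \<in> H"
  using derives.EqlI derives_iff by blast

lemma Eql_subst: "(i \<^bold>= j) \<in> H \<Longrightarrow> inst i p \<in> H \<Longrightarrow> inst j p \<in> H"
  using derives.EqlE derives_iff by blast

lemma Eql_sym: "(i \<^bold>= j) \<in> H \<Longrightarrow> (j \<^bold>= i) \<in> H"
  \<comment> \<open>In these patterns index 0 marks the place of substitution, and
    \<open>Suc i\<close> denotes the outer variable \<open>i\<close>.\<close>
  using Eql_subst[of i j "0 \<^bold>= Suc i"] Eql_refl by (simp add: inst_def)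

lemma Eql_trans: "(i \<^bold>= j) \<in> H \<Longrightarrow> (j \<^bold>= k) \<in> H \<Longrightarrow> (i \<^bold>= k) \<in> H"
  using Eql_subst[of j k "Suc i \<^bold>= 0"] by (simp add: inst_def)

lemma Mem_cong:
  assumes "(i \<^bold>= i') \<in> H" and "(j \<^bold>= j') \<in> H" and "(i \<^bold>\<in> j) \<in> H"
  shows "(i' \<^bold>\<in> j') \<in> H"
  using Eql_subst[OF assms(1), of "0 \<^bold>\<in> Suc j"] Eql_subst[OF assms(2), of "Suc i' \<^bold>\<in> 0"] assms(3)
  by (simp add: inst_def)

text \<open>Least representatives replace equivalence classes, which keeps the domain of the model a
  set of natural numbers.\<close>

definition rep :: "nat \<Rightarrow> nat"
  where "rep i = (LEAST j. (i \<^bold>= j) \<in> H)"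

lemma rep_Eql: "(i \<^bold>= rep i) \<in> H"
  unfolding rep_def by (rule LeastI, rule Eql_refl)

lemma rep_eq_iff: "rep i = rep j \<longleftrightarrow> (i \<^bold>= j) \<in> H"
proof
  show "rep i = rep j \<Longrightarrow> (i \<^bold>= j) \<in> H" using rep_Eql Eql_sym Eql_trans by metis
next
  assume "(i \<^bold>= j) \<in> H"
  then have "(i \<^bold>= k) \<in> H \<longleftrightarrow> (j \<^bold>= k) \<in> H" for k using Eql_sym Eql_trans by blast
  then show "rep i = rep j" unfolding rep_def by simp
qed

definition mem_rel :: "nat rel"
  where "mem_rel = {(rep i, rep j) |i j. (i \<^bold>\<in> j) \<in> H}"

lemma mem_rel_iff: "(rep i, rep j) \<in> mem_rel \<longleftrightarrow> (i \<^bold>\<in> j) \<in> H"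
proof -
  have "(i \<^bold>\<in> j) \<in> H" if "rep i = rep i'" "rep j = rep j'" "(i' \<^bold>\<in> j') \<in> H" for i' j'
    using that Mem_cong Eql_sym by (metis rep_eq_iff)
  then show ?thesis unfolding mem_rel_def by auto
qed

text \<open>The truth lemma. It is stated for every renaming \<open>f\<close> because the quantifier
  case passes from \<open>f\<close> to \<open>case_nat k f\<close>; the witnesses enter through
  \<open>FAll_iff\<close>.\<close>

lemma sat_ren_iff: "sat (range rep) mem_rel (\<lambda>k. rep (f k)) p \<longleftrightarrow> ren f p \<in> H"
proof (induction p arbitrary: f)
  case (FAll p)
  have "case_nat (rep k) (\<lambda>k. rep (f k)) = (\<lambda>j. rep (case_nat k f j))" for k
    by (rule ext) (simp split: nat.split)
  then show ?case by (simp add: FAll.IH FAll_iff inst_ren)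
qed (simp_all add: mem_rel_iff rep_eq_iff Imp_iff Fls_iff)

lemma sat_iff: "sat (range rep) mem_rel rep p \<longleftrightarrow> p \<in> H"
  using sat_ren_iff[of "\<lambda>k. k"] by (simp add: ren_ident)

end

text \<open>The requirements \<open>Q n\<close> are met at stage \<open>n\<close> of the construction, which is what allows types
  to be realised along with the Henkin witnesses.\<close>

theorem henkin_model:
  fixes Q :: "nat \<Rightarrow> fm set \<Rightarrow> bool"
  assumes con: "consistent \<Gamma>" and fin: "finite (Fv \<Gamma>)"
    and step: "\<And>n \<Delta>. \<Gamma> \<subseteq> \<Delta> \<Longrightarrow> consistent \<Delta> \<Longrightarrow> finite (Fv \<Delta>) \<Longrightarrow>
      \<exists>\<Delta>'. \<Delta> \<subseteq> \<Delta>' \<and> consistent \<Delta>' \<and> finite (Fv \<Delta>') \<and> Q n \<Delta>'"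
    and mono: "\<And>n \<Delta> \<Delta>'. Q n \<Delta> \<Longrightarrow> \<Delta> \<subseteq> \<Delta>' \<Longrightarrow> Q n \<Delta>'"
  obtains W :: "nat set" and E :: "nat rel" and r :: "nat \<Rightarrow> nat"
  where "range r = W" and "E \<subseteq> W \<times> W" and "\<And>p. p \<in> \<Gamma> \<Longrightarrow> sat W E r p"
    and "\<And>n. Q n {p. sat W E r p}"
proof -
  let ?P = "\<lambda>n \<Delta>. \<Gamma> \<subseteq> \<Delta> \<and> consistent \<Delta> \<and> finite (Fv \<Delta>)"
  \<comment> \<open>Stage \<open>n\<close> decides the \<open>n\<close>-th formula and meets the
    \<open>n\<close>-th requirement. Both properties persist when the set grows.\<close>
  let ?R = "\<lambda>n \<Delta> \<Delta>'. \<Delta> \<subseteq> \<Delta>' \<and> Q n \<Delta>' \<and> decides \<Delta>' (from_nat n)"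
  have "\<exists>S. \<forall>n. ?P n (S n) \<and> ?R n (S n) (S (Suc n))"
  proof (rule dependent_nat_choice)
    show "\<exists>\<Delta>. ?P 0 \<Delta>" using con fin by blast
  next
    fix \<Delta> n assume P: "?P n \<Delta>"
    obtain \<Delta>1 where 1: "\<Delta> \<subseteq> \<Delta>1" "consistent \<Delta>1" "finite (Fv \<Delta>1)" "decides \<Delta>1 (from_nat n)"
      using henkin_step[of \<Delta> "from_nat n"] P by blast
    obtain \<Delta>2 where 2: "\<Delta>1 \<subseteq> \<Delta>2" "consistent \<Delta>2" "finite (Fv \<Delta>2)" "Q n \<Delta>2"
      using step[of \<Delta>1 n] 1 P by blast
    show "\<exists>\<Delta>'. ?P (Suc n) \<Delta>' \<and> ?R n \<Delta> \<Delta>'"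
      using P 1(1) 2 decides_mono[OF 1(4) 2(1)] by (intro exI[of _ \<Delta>2]) auto
  qed
  then obtain S where S: "\<And>n. ?P n (S n)" "\<And>n. ?R n (S n) (S (Suc n))" by blast
  interpret henkin_set "\<Union>n. S n"
  proof
    show "consistent (\<Union>n. S n)"
      using S by (intro consistent_Union_chain) (simp_all add: mono_iff_le_Suc)
  next
    fix p
    show "p \<in> (\<Union>n. S n) \<or> \<^bold>\<not> p \<in> (\<Union>n. S n)"
      using S(2)[of "to_nat p"] by (auto simp: decides_def)
  next
    fix p
    show "FAll p \<in> (\<Union>n. S n) \<or> (\<exists>k. \<^bold>\<not> inst k p \<in> (\<Union>n. S n))"
      using S(2)[of "to_nat (FAll p)"] by (simp add: decides_def) blast
  qed
  show thesis
  proof (rule that)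
    show "mem_rel \<subseteq> range rep \<times> range rep" unfolding mem_rel_def by auto
    show "sat (range rep) mem_rel rep p" if "p \<in> \<Gamma>" for p
      using that S(1) by (auto simp: sat_iff)
    show "Q n {p. sat (range rep) mem_rel rep p}" for n
      by (rule mono[of n "S (Suc n)"]) (use S(2)[of n] in \<open>auto simp: sat_iff\<close>)
  qed simp
qed


section \<open>Splitting set fields\<close>

text \<open>A ring of sets without a largest element \<open>W\<close>. The assumption
  \<open>split\<close> says that the ring modulo finite sets is atomless; \<open>disjoint\<close>
  provides the same splitting for complements of members.\<close>

locale splitting_field =
  fixes W :: "'a set" and \<B> :: "'a set set"
  assumes sub: "X \<in> \<B> \<Longrightarrow> X \<subseteq> W"
    and fin: "finite X \<Longrightarrow> X \<subseteq> W \<Longrightarrow> X \<in> \<B>"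
    and un: "X \<in> \<B> \<Longrightarrow> Y \<in> \<B> \<Longrightarrow> X \<union> Y \<in> \<B>"
    and diff: "X \<in> \<B> \<Longrightarrow> Y \<in> \<B> \<Longrightarrow> X - Y \<in> \<B>"
    and proper: "W \<notin> \<B>"
    and split: "X \<in> \<B> \<Longrightarrow> infinite X \<Longrightarrow> \<exists>Y\<in>\<B>. Y \<subseteq> X \<and> infinite Y \<and> infinite (X - Y)"
    and disjoint: "X \<in> \<B> \<Longrightarrow> \<exists>Y\<in>\<B>. X \<inter> Y = {} \<and> infinite Y"
begin

text \<open>The members of the field and their complements: cutting \<open>W\<close> by finitely
  many members of the field produces only such sets.\<close>

definition region :: "'a set \<Rightarrow> bool"
  where "region U \<longleftrightarrow> U \<subseteq> W \<and> (U \<in> \<B> \<or> W - U \<in> \<B>)"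

lemma inter: "X \<in> \<B> \<Longrightarrow> Y \<in> \<B> \<Longrightarrow> X \<inter> Y \<in> \<B>"
  using diff[of X "X - Y"] diff[of X Y] by (simp add: Diff_Diff_Int)

lemma region_inter: "region U \<Longrightarrow> X \<in> \<B> \<Longrightarrow> U \<inter> X \<in> \<B>"
proof -
  assume U: "region U" and X: "X \<in> \<B>"
  have "U \<inter> X = X - (W - U)" using sub[OF X] by auto
  then show ?thesis using U X inter diff unfolding region_def by metis
qed

lemma region_diff: "region U \<Longrightarrow> X \<in> \<B> \<Longrightarrow> region (U - X)"
proof -
  assume U: "region U" and X: "X \<in> \<B>"
  have "W - (U - X) = (W - U) \<union> X" using sub[OF X] by auto
  then show ?thesis using U X un diff unfolding region_def by auto
qed

lemma region_mem: "X \<in> \<B> \<Longrightarrow> region X"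
  using sub by (simp add: region_def)

lemma region_W: "region W"
  using fin[of "{}"] by (simp add: region_def)

text \<open>The part \<open>U \<inter> X\<close> always lies in the field, so cutting it off does
  not change whether a region belongs to the field.\<close>

lemma diff_mem_iff: "region U \<Longrightarrow> X \<in> \<B> \<Longrightarrow> U - X \<in> \<B> \<longleftrightarrow> U \<in> \<B>"
  using un[of "U - X" "U \<inter> X"] region_inter diff by (metis Un_Diff_Int)

text \<open>For a region outside the field, \<open>disjoint\<close> applied to its complement gives
  an infinite \<open>Y\<close> inside it. The remainder is again outside the field, hence infinite,
  since all finite subsets are members.\<close>

lemma region_split:
  assumes "region U" and "infinite U"
  shows "\<exists>Y\<in>\<B>. Y \<subseteq> U \<and> infinite Y \<and> infinite (U - Y)"
proof (cases "U \<in> \<B>")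
  case True
  then show ?thesis using split assms by blast
next
  case False
  then have "W - U \<in> \<B>" using assms by (simp add: region_def)
  then obtain Y where Y: "Y \<in> \<B>" "(W - U) \<inter> Y = {}" "infinite Y" using disjoint by blast
  have "infinite (U - Y)"
    using False diff_mem_iff[OF assms(1) Y(1)] fin assms(1) unfolding region_def by blast
  moreover have "Y \<subseteq> U" using Y sub by blast
  ultimately show ?thesis using Y by blast
qed

end

section \<open>Back-and-forth between two splitting fields\<close>

locale two_splitting_fields = F: splitting_field W \<B> + G: splitting_field W' \<B>'
  for W :: "'a set" and \<B> and W' :: "'b set" and \<B>'
begin

text \<open>Finiteness is compared separately because \<open>card\<close> is 0 for infinite sets as
  well as for the empty set.\<close>

definition same :: "'a set \<Rightarrow> 'b set \<Rightarrow> bool"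
  where "same U V \<longleftrightarrow> (finite U \<longleftrightarrow> finite V) \<and> card U = card V \<and> (U \<in> \<B> \<longleftrightarrow> V \<in> \<B>')"

text \<open>Every cell of the partition of \<open>U\<close> induced by the first components of \<open>ps\<close> matches the
  corresponding cell of the partition of \<open>V\<close> induced by the second components.\<close>

fun cells :: "('a set \<times> 'b set) list \<Rightarrow> 'a set \<Rightarrow> 'b set \<Rightarrow> bool" where
  "cells [] U V \<longleftrightarrow> same U V"
| "cells ((X, Y) # ps) U V \<longleftrightarrow> cells ps (U \<inter> X) (V \<inter> Y) \<and> cells ps (U - X) (V - Y)"

text \<open>One extension step inside a single cell. A suitable \<open>Y\<close> is sought inside
  \<open>V\<close>, according to which of the two parts of \<open>U\<close> are finite.\<close>

lemma same_split:
  assumes U: "F.region U" and V: "G.region V" and same: "same U V" and X: "X \<in> \<B>"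
  shows "\<exists>Y\<in>\<B>'. same (U \<inter> X) (V \<inter> Y) \<and> same (U - X) (V - Y)"
proof -
  have UX: "U \<inter> X \<in> \<B>" by (rule F.region_inter[OF U X])
  have VW: "V \<subseteq> W'" using V by (simp add: G.region_def)
  \<comment> \<open>For \<open>Y\<close> in the field, field membership of the parts matches by
    \<open>diff_mem_iff\<close>, so that only their sizes remain to be compared.\<close>
  have *: ?thesis if Y: "Y \<in> \<B>'" "Y \<subseteq> V" and "finite (U \<inter> X) \<longleftrightarrow> finite Y"
      "card (U \<inter> X) = card Y" "finite (U - X) \<longleftrightarrow> finite (V - Y)" "card (U - X) = card (V - Y)" for Y
  proof -
    have "V \<inter> Y = Y" using Y by blast
    then show ?thesis
      using that UX F.diff_mem_iff[OF U X] G.diff_mem_iff[OF V Y(1)] same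
      by (intro bexI[of _ Y]) (auto simp: same_def)
  qed
  have U_eq: "(U \<inter> X) \<union> (U - X) = U" by auto
  consider "finite (U \<inter> X)" | "infinite (U \<inter> X)" "finite (U - X)" | "infinite (U \<inter> X)" "infinite (U - X)"
    by blast
  then show ?thesis
  proof cases
    case 1
    have "\<exists>Y\<subseteq>V. finite Y \<and> card Y = card (U \<inter> X)"
    proof (cases "finite U")
      case True
      then have "card (U \<inter> X) \<le> card V" "finite V"
        using same card_mono[of U "U \<inter> X"] by (auto simp: same_def)
      then show ?thesis by (metis finite_subset obtain_subset_with_card_n)
    next
      case False
      then show ?thesis using same unfolding same_def by (metis infinite_arbitrarily_large)
    qed
    then obtain Y where Y: "Y \<subseteq> V" "finite Y" "card Y = card (U \<inter> X)" by blast
    have "card (U - X) = card U - card (U \<inter> X)"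
      using 1 by (simp add: card_Diff_subset_Int)
    moreover have "card (V - Y) = card V - card Y" using Y by (simp add: card_Diff_subset)
    moreover have "finite (U - X) \<longleftrightarrow> finite U" using 1 U_eq finite_UnI[of "U \<inter> X" "U - X"] by auto
    moreover have "finite (V - Y) \<longleftrightarrow> finite V" using Y by simp
    ultimately show ?thesis using 1 Y same VW G.fin by (intro *[of Y]) (auto simp: same_def)
  next
    case 2
    \<comment> \<open>Here the finite remainder is matched instead of the intersection. It forces
      \<open>U\<close>, hence \<open>V\<close>, into the field, so that \<open>V - Z\<close> is a
      member.\<close>
    then have "U - X \<in> \<B>" using U by (intro F.fin) (auto simp: F.region_def)
    then have "U \<in> \<B>" using F.diff_mem_iff[OF U X] by simp
    then have V\<B>: "V \<in> \<B>'" "infinite V" using same 2 unfolding same_def by auto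
    then obtain Z where Z: "Z \<subseteq> V" "finite Z" "card Z = card (U - X)"
      by (metis infinite_arbitrarily_large)
    then have "V - (V - Z) = Z" "infinite (V - Z)" using V\<B> by auto
    moreover have "V - Z \<in> \<B>'" using Z V\<B> VW G.fin G.diff by (meson subset_trans)
    ultimately show ?thesis using 2 Z by (intro *[of "V - Z"]) auto
  next
    case 3
    \<comment> \<open>Both parts are infinite, so any split of \<open>V\<close> into two infinite
      parts by a member of the field will do.\<close>
    then have "infinite V" using same unfolding same_def by (metis finite_Int)
    then obtain Y where "Y \<in> \<B>'" "Y \<subseteq> V" "infinite Y" "infinite (V - Y)"
      using G.region_split[OF V] by blast
    then show ?thesis using 3 by (intro *[of Y]) auto
  qed
qed

text \<open>Only the trace of the last set on \<open>V\<close> matters, which permits sets chosen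
  separately in disjoint cells to be glued.\<close>

lemma cells_snoc_cong:
  "V \<inter> Y = V \<inter> Y' \<Longrightarrow> cells (ps @ [(X, Y)]) U V \<longleftrightarrow> cells (ps @ [(X, Y')]) U V"
proof (induction ps arbitrary: U V)
  case Nil
  then have "V - Y = V - Y'" by blast
  then show ?case using Nil by simp
next
  case (Cons p ps)
  obtain X0 Y0 where p: "p = (X0, Y0)" by fastforce
  have "(V \<inter> Y0) \<inter> Y = (V \<inter> Y0) \<inter> Y'" "(V - Y0) \<inter> Y = (V - Y0) \<inter> Y'" using Cons.prems by blast+
  then show ?case using Cons.IH by (simp add: p)
qed

lemma cells_extend:
  assumes "X \<in> \<B>"
  shows "F.region U \<Longrightarrow> G.region V \<Longrightarrow> set ps \<subseteq> \<B> \<times> \<B>' \<Longrightarrow> cells ps U V \<Longrightarrow>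
    \<exists>Y\<in>\<B>'. cells (ps @ [(X, Y)]) U V"
proof (induction ps arbitrary: U V)
  case Nil
  then show ?case using same_split[OF Nil(1,2) _ assms] by simp
next
  case (Cons p ps)
  obtain X0 Y0 where p: "p = (X0, Y0)" by fastforce
  have XY: "X0 \<in> \<B>" "Y0 \<in> \<B>'" using Cons.prems p by auto
  have "F.region (U \<inter> X0)" "G.region (V \<inter> Y0)" "F.region (U - X0)" "G.region (V - Y0)"
    using Cons.prems XY F.region_inter F.region_mem G.region_inter G.region_mem
      F.region_diff G.region_diff by auto
  then have "\<exists>Y1\<in>\<B>'. cells (ps @ [(X, Y1)]) (U \<inter> X0) (V \<inter> Y0)"
      "\<exists>Y2\<in>\<B>'. cells (ps @ [(X, Y2)]) (U - X0) (V - Y0)"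
    using Cons.prems p by (auto intro!: Cons.IH)
  then obtain Y1 Y2 where Y: "Y1 \<in> \<B>'" "cells (ps @ [(X, Y1)]) (U \<inter> X0) (V \<inter> Y0)"
      "Y2 \<in> \<B>'" "cells (ps @ [(X, Y2)]) (U - X0) (V - Y0)"
    by blast
  \<comment> \<open>Inside \<open>Y0\<close> the glued set agrees with \<open>Y1\<close> and outside
    with \<open>Y2\<close>, so each branch sees only its own choice.\<close>
  let ?Y = "(Y1 \<inter> Y0) \<union> (Y2 - Y0)"
  have "(V \<inter> Y0) \<inter> ?Y = (V \<inter> Y0) \<inter> Y1" "(V - Y0) \<inter> ?Y = (V - Y0) \<inter> Y2" by auto
  then have "cells (ps @ [(X, ?Y)]) (U \<inter> X0) (V \<inter> Y0)" "cells (ps @ [(X, ?Y)]) (U - X0) (V - Y0)"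
    using Y(2,4) by (simp_all add: cells_snoc_cong[of _ ?Y Y1] cells_snoc_cong[of _ ?Y Y2])
  moreover have "?Y \<in> \<B>'" using Y XY by (intro G.un G.inter G.diff)
  ultimately show ?case by (intro bexI[of _ ?Y]) (simp_all add: p)
qed

lemma cells_empty_iff: "cells ps U V \<Longrightarrow> U = {} \<longleftrightarrow> V = {}"
proof (induction ps U V rule: cells.induct)
  case (1 U V)
  then show ?case by (auto simp: same_def)
qed auto

lemma cells_disjoint_iff: "cells ps U V \<Longrightarrow> (X, Y) \<in> set ps \<Longrightarrow> U \<inter> X = {} \<longleftrightarrow> V \<inter> Y = {}"
proof (induction ps U V rule: cells.induct)
  case (2 X0 Y0 ps U V)
  show ?case
  proof (cases "(X, Y) = (X0, Y0)")
    case True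
    then show ?thesis using 2 cells_empty_iff[of ps "U \<inter> X0" "V \<inter> Y0"] by simp
  next
    case False
    then show ?thesis using 2 by auto
  qed
qed simp

lemma cells_subset_iff: "cells ps U V \<Longrightarrow> (X, Y) \<in> set ps \<Longrightarrow> U \<subseteq> X \<longleftrightarrow> V \<subseteq> Y"
proof (induction ps U V rule: cells.induct)
  case (2 X0 Y0 ps U V)
  show ?case
  proof (cases "(X, Y) = (X0, Y0)")
    case True
    then show ?thesis using 2 cells_empty_iff[of ps "U - X0" "V - Y0"] by auto
  next
    case False
    then show ?thesis using 2 by auto
  qed
qed simp

text \<open>An inclusion says that certain cells are empty, and matching cells are empty together.
  If one of the two pairs is the head of the list, the claim becomes a containment or a disjointness
  in one of its two branches.\<close>

lemma cells_mono_iff: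
  "cells ps U V \<Longrightarrow> (X, Y) \<in> set ps \<Longrightarrow> (X', Y') \<in> set ps \<Longrightarrow>
    U \<inter> X \<subseteq> X' \<longleftrightarrow> V \<inter> Y \<subseteq> Y'"
proof (induction ps U V rule: cells.induct)
  case (2 X0 Y0 ps U V)
  have c: "cells ps (U \<inter> X0) (V \<inter> Y0)" "cells ps (U - X0) (V - Y0)" using 2 by auto
  consider "(X, Y) = (X0, Y0)" "(X', Y') = (X0, Y0)"
    | "(X, Y) = (X0, Y0)" "(X', Y') \<in> set ps"
    | "(X, Y) \<in> set ps" "(X', Y') = (X0, Y0)"
    | "(X, Y) \<in> set ps" "(X', Y') \<in> set ps"
    using 2 by auto
  then show ?case
  proof cases
    case 2
    then show ?thesis using cells_subset_iff[OF c(1)] by auto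
  next
    case 3
    then show ?thesis using cells_disjoint_iff[OF c(2), of X Y] by auto
  next
    case 4
    then have "(U \<inter> X0) \<inter> X \<subseteq> X' \<longleftrightarrow> (V \<inter> Y0) \<inter> Y \<subseteq> Y'"
        "(U - X0) \<inter> X \<subseteq> X' \<longleftrightarrow> (V - Y0) \<inter> Y \<subseteq> Y'"
      using "2.IH"(1)[OF c(1)] "2.IH"(2)[OF c(2)] by simp_all
    then show ?thesis by blast
  qed auto
qed simp

end

text \<open>Matching is symmetric. The lemma stands outside the locale so that both orientations can
  be interpreted; it turns the forth step into the back step.\<close>

lemma cells_swap:
  assumes "two_splitting_fields W \<B> W' \<B>'"
  shows "two_splitting_fields.cells \<B>' \<B> (map prod.swap ps) V U \<longleftrightarrow>
    two_splitting_fields.cells \<B> \<B>' ps U V"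
proof -
  interpret A: two_splitting_fields W \<B> W' \<B>' by (rule assms)
  interpret B: two_splitting_fields W' \<B>' W \<B> ..
  show ?thesis
    by (induction ps U V rule: A.cells.induct) (auto simp: A.same_def B.same_def)
qed

context two_splitting_fields
begin

lemma cells_extend_back:
  assumes "Y \<in> \<B>'" and "set ps \<subseteq> \<B> \<times> \<B>'" and "cells ps W W'"
  shows "\<exists>X\<in>\<B>. cells (ps @ [(X, Y)]) W W'"
proof -
  interpret B: two_splitting_fields W' \<B>' W \<B> ..
  have tf: "two_splitting_fields W \<B> W' \<B>'" ..
  have "\<exists>X\<in>\<B>. B.cells (map prod.swap ps @ [(Y, X)]) W' W"
    using assms by (intro B.cells_extend F.region_W G.region_W) (auto simp: cells_swap[OF tf])
  moreover have "map prod.swap ps @ [(Y, X)] = map prod.swap (ps @ [(X, Y)])" for X by simp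
  ultimately show ?thesis using cells_swap[OF tf] by metis
qed

text \<open>The start of the back-and-forth: finite subsets of a domain are members of its field and
  the domain is not, so both domains are infinite and outside their fields.\<close>

lemma cells_Nil: "cells [] W W'"
proof -
  have "infinite W" "infinite W'" using F.fin F.proper G.fin G.proper by blast+
  then show ?thesis using F.proper G.proper by (simp add: same_def)
qed

theorem inclusion_isomorphic:
  assumes "countable \<B>" and "countable \<B>'"
  obtains g where "bij_betw g \<B> \<B>'" and "\<And>X Y. X \<in> \<B> \<Longrightarrow> Y \<in> \<B> \<Longrightarrow> X \<subseteq> Y \<longleftrightarrow> g X \<subseteq> g Y"
proof -
  have ne: "\<B> \<noteq> {}" "\<B>' \<noteq> {}" using F.fin G.fin by blast+
  let ?X = "from_nat_into \<B>" and ?Y = "from_nat_into \<B>'"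
  \<comment> \<open>Stage \<open>n\<close> adds a partner for the \<open>n\<close>-th member of each
    field.\<close>
  have "\<exists>S. \<forall>n. (set (S n) \<subseteq> \<B> \<times> \<B>' \<and> cells (S n) W W') \<and>
      (set (S n) \<subseteq> set (S (Suc n)) \<and> ?X n \<in> fst ` set (S (Suc n)) \<and> ?Y n \<in> snd ` set (S (Suc n)))"
  proof (rule dependent_nat_choice)
    show "\<exists>ps. set ps \<subseteq> \<B> \<times> \<B>' \<and> cells ps W W'" using cells_Nil by (intro exI[of _ "[]"]) simp
  next
    fix ps n assume ps: "set ps \<subseteq> \<B> \<times> \<B>' \<and> cells ps W W'"
    have X: "?X n \<in> \<B>" and Y: "?Y n \<in> \<B>'" using ne from_nat_into by blast+
    obtain Y0 where Y0: "Y0 \<in> \<B>'" "cells (ps @ [(?X n, Y0)]) W W'"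
      using cells_extend[OF X F.region_W G.region_W] ps by blast
    obtain X0 where "X0 \<in> \<B>" "cells ((ps @ [(?X n, Y0)]) @ [(X0, ?Y n)]) W W'"
      using cells_extend_back[OF Y _ Y0(2)] ps X Y0(1) by auto
    then show "\<exists>qs. (set qs \<subseteq> \<B> \<times> \<B>' \<and> cells qs W W') \<and>
        (set ps \<subseteq> set qs \<and> ?X n \<in> fst ` set qs \<and> ?Y n \<in> snd ` set qs)"
      using ps X Y Y0 by (intro exI[of _ "(ps @ [(?X n, Y0)]) @ [(X0, ?Y n)]"]) auto
  qed
  then obtain S where S: "\<And>n. set (S n) \<subseteq> \<B> \<times> \<B>'" "\<And>n. cells (S n) W W'"
      "\<And>n. set (S n) \<subseteq> set (S (Suc n))" "\<And>n. ?X n \<in> fst ` set (S (Suc n))"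
      "\<And>n. ?Y n \<in> snd ` set (S (Suc n))"
    by metis
  define R where "R = (\<Union>n. set (S n))"
  have le: "set (S m) \<subseteq> set (S n)" if "m \<le> n" for m n
    using that S(3) lift_Suc_mono_le[of "\<lambda>n. set (S n)"] by blast
  \<comment> \<open>Any two pairs in \<open>R\<close> occur together in some list, where matching of
    cells preserves inclusion.\<close>
  have R: "X \<subseteq> X' \<longleftrightarrow> Y \<subseteq> Y'" if XY: "(X, Y) \<in> R" "(X', Y') \<in> R" for X Y X' Y'
  proof -
    obtain m n where "(X, Y) \<in> set (S m)" "(X', Y') \<in> set (S n)" using XY R_def by blast
    then have mem: "(X, Y) \<in> set (S (max m n))" "(X', Y') \<in> set (S (max m n))"
      using le[of m "max m n"] le[of n "max m n"] by auto
    then have "X \<subseteq> W" "Y \<subseteq> W'" using S(1) F.sub G.sub by blast+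
    then have "W \<inter> X = X" "W' \<inter> Y = Y" by auto
    then show ?thesis using cells_mono_iff[OF S(2) mem] by simp
  qed
  have R_sub: "R \<subseteq> \<B> \<times> \<B>'" unfolding R_def using S(1) by blast
  have "\<exists>Y. (X, Y) \<in> R" if "X \<in> \<B>" for X
    using S(4)[of "to_nat_on \<B> X"] that assms(1) by (fastforce simp: R_def)
  then obtain g where g: "\<And>X. X \<in> \<B> \<Longrightarrow> (X, g X) \<in> R" by metis
  have "\<exists>X. (X, Y) \<in> R" if "Y \<in> \<B>'" for Y
    using S(5)[of "to_nat_on \<B>' Y"] that assms(2) by (fastforce simp: R_def)
  \<comment> \<open>Comparing \<open>X\<close> with itself through the two pairs gives inclusions
    both ways, so \<open>R\<close> is single-valued.\<close>
  moreover have "Y = g X" if "(X, Y) \<in> R" for X Y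
    using that R[of X Y X "g X"] R[of X "g X" X Y] g[of X] R_sub by blast
  ultimately have surj: "\<exists>X\<in>\<B>. Y = g X" if "Y \<in> \<B>'" for Y
    using that R_sub by blast
  have mono: "X \<subseteq> Y \<longleftrightarrow> g X \<subseteq> g Y" if "X \<in> \<B>" "Y \<in> \<B>" for X Y
    using R[OF g[OF that(1)] g[OF that(2)]] .
  have "bij_betw g \<B> \<B>'"
    unfolding bij_betw_def
  proof
    show "inj_on g \<B>" using mono by (metis inj_onI order_refl subset_antisym)
    show "g ` \<B> = \<B>'" using g R_sub surj by blast
  qed
  then show thesis using mono that by blast
qed

end


section \<open>Models of set theory\<close>

definition members :: "'a set \<Rightarrow> 'a rel \<Rightarrow> 'a \<Rightarrow> 'a set"
  where "members W E u = {a \<in> W. (a, u) \<in> E}"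

text \<open>The fragment of set theory that suffices both for satisfying the types finitely and for
  the closure properties of the field of member sets.\<close>

locale set_model =
  fixes W :: "'a set" and E :: "'a rel"
  assumes nonempty: "W \<noteq> {}"
    and extensional: "u \<in> W \<Longrightarrow> v \<in> W \<Longrightarrow> members W E u = members W E v \<Longrightarrow> u = v"
    and ex_singleton: "a \<in> W \<Longrightarrow> \<exists>w\<in>W. members W E w = {a}"
    and ex_union: "u \<in> W \<Longrightarrow> v \<in> W \<Longrightarrow> \<exists>w\<in>W. members W E w = members W E u \<union> members W E v"
    and ex_diff: "u \<in> W \<Longrightarrow> v \<in> W \<Longrightarrow> \<exists>w\<in>W. members W E w = members W E u - members W E v"
    and not_universal: "u \<in> W \<Longrightarrow> members W E u \<noteq> W"
begin

lemma ex_finite: "finite X \<Longrightarrow> X \<subseteq> W \<Longrightarrow> \<exists>w\<in>W. members W E w = X"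
proof (induction X rule: finite_induct)
  case empty
  obtain u where "u \<in> W" using nonempty by blast
  then show ?case using ex_diff[of u u] by simp
next
  case (insert a X)
  then obtain u v where "u \<in> W" "members W E u = {a}" "v \<in> W" "members W E v = X"
    using ex_singleton[of a] by auto
  then show ?case using ex_union[of u v] by simp
qed

text \<open>A finite complement would itself be a member set, and its union with the members of
  \<open>u\<close> would give a universal set.\<close>

lemma infinite_nonmembers: "u \<in> W \<Longrightarrow> infinite (W - members W E u)"
proof
  assume u: "u \<in> W" and "finite (W - members W E u)"
  then obtain v where "v \<in> W" "members W E v = W - members W E u" using ex_finite by blast
  then obtain w where "w \<in> W" "members W E w = members W E u \<union> (W - members W E u)"
    using ex_union[OF u] by metis
  then show False using not_universal by (auto simp: members_def)
qed

end

section \<open>From the axioms of ZFC to operations on member sets\<close>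

lemma fv_QAll: "fv (\<^bold>\<forall>x. p) = fv p - {x}"
  by (auto simp: QAll_def fv_ren split: if_splits)

lemma fv_FAll_pow: "fv ((FAll ^^ n) p) = {k. k + n \<in> fv p}"
  by (induction n) auto

text \<open>Every valuation is its head put in front of its tail, so validity under all valuations
  passes through each quantifier of the prefix.\<close>

lemma sat_FAll_powD:
  assumes "\<And>v. range v \<subseteq> W \<Longrightarrow> sat W E v ((FAll ^^ n) p)"
  shows "range v \<subseteq> W \<Longrightarrow> sat W E v p"
  using assms
proof (induction n arbitrary: v)
  case (Suc n)
  show ?case
  proof (rule Suc.IH[OF Suc.prems(1)])
    fix v :: "nat \<Rightarrow> 'a" assume v: "range v \<subseteq> W"
    have "range (\<lambda>k. v (Suc k)) \<subseteq> W" "v 0 \<in> W" using v by auto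
    moreover have "case_nat (v 0) (\<lambda>k. v (Suc k)) = v" by (rule ext) (simp split: nat.split)
    ultimately show "sat W E v ((FAll ^^ n) p)"
      using Suc.prems(2)[of "\<lambda>k. v (Suc k)"] by (simp, metis)
  qed
qed simp

text \<open>Required because \<open>extends\<close> compares theories on sentences only.\<close>

lemma sentence_ZFC: "p \<in> ZFC \<Longrightarrow> sentence p"
  by (auto simp: ZFC_def Separation_scheme_def Replacement_scheme_def Let_def sentence_def fv_QAll
      Extensionality_def Foundation_def Pairing_def Unions_def Powerset_def Infinity_def Choice_def)

lemma models_ZFC_if_extends:
  fixes W :: "'a set"
  assumes "models W E T" and "extends T ZFC"
  shows "models W E ZFC"
  unfolding models_def
proof (intro conjI ballI allI impI)
  show "W \<noteq> {}" using assms(1) by (simp add: models_def)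
  fix p and v :: "nat \<Rightarrow> 'a" assume "p \<in> ZFC" and v: "range v \<subseteq> W"
  then have "T \<turnstile> p" using assms(2) sentence_ZFC by (simp add: extends_def derives.Assm)
  then show "sat W E v p"
    using v by (rule derives_sound) (use assms(1) v in \<open>simp add: models_def\<close>)
qed

lemma models_Separation:
  assumes M: "models W E ZFC" and fv: "2 \<notin> fv \<phi>" and v: "range v \<subseteq> W" and a: "a \<in> W"
  shows "\<exists>b\<in>W. \<forall>x\<in>W. (x, b) \<in> E \<longleftrightarrow> (x, a) \<in> E \<and> sat W E (v(1 := a, 0 := x)) \<phi>"
proof -
  let ?p = "\<^bold>\<forall>1. \<^bold>\<exists>2. \<^bold>\<forall>0. (0 \<^bold>\<in> 2 \<^bold>\<longleftrightarrow> (0 \<^bold>\<in> 1 \<^bold>\<and> \<phi>))"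
  \<comment> \<open>A prefix longer than every free index closes the formula, making it an instance
    of the scheme.\<close>
  obtain n where "\<forall>k\<in>fv ?p. k < n" using finite_fv finite_nat_set_iff_bounded by blast
  then have "sentence ((FAll ^^ n) ?p)" by (fastforce simp: sentence_def fv_FAll_pow)
  then have "(FAll ^^ n) ?p \<in> ZFC"
    using fv unfolding ZFC_def Separation_scheme_def Let_def by blast
  then have "sat W E v ?p"
    using M v sat_FAll_powD[of W E n ?p] unfolding models_def by blast
  then obtain b where b: "b \<in> W" "\<And>x. x \<in> W \<Longrightarrow>
      (x, b) \<in> E \<longleftrightarrow> (x, a) \<in> E \<and> sat W E (v(1 := a, 2 := b, 0 := x)) \<phi>"
    using a by (simp add: sat_QAll) blast
  have "sat W E (v(1 := a, 2 := b, 0 := x)) \<phi> \<longleftrightarrow> sat W E (v(1 := a, 0 := x)) \<phi>" for x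
    using fv by (intro sat_cong) auto
  then show ?thesis using b by auto
qed

lemma set_model_if_models_ZFC:
  assumes M: "models W E ZFC"
  shows "set_model W E"
proof -
  obtain e where e: "e \<in> W" using M unfolding models_def by blast
  let ?v = "\<lambda>_::nat. e"
  have v: "range ?v \<subseteq> W" using e by auto
  have ax: "sat W E ?v p" if "p \<in> ZFC" for p using M v that unfolding models_def by blast
  have Ext: "a = b" if "a \<in> W" "b \<in> W" "\<forall>c\<in>W. (c, a) \<in> E \<longleftrightarrow> (c, b) \<in> E" for a b
    using ax[of Extensionality] that by (auto simp: ZFC_def Extensionality_def Let_def sat_QAll)
  have Pair: "\<exists>c\<in>W. \<forall>d\<in>W. (d, c) \<in> E \<longleftrightarrow> d = a \<or> d = b" if "a \<in> W" "b \<in> W" for a b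
  proof -
    have "sat W E ?v Pairing" by (rule ax) (simp add: ZFC_def)
    then have "\<forall>a\<in>W. \<forall>b\<in>W. \<exists>c\<in>W. \<forall>d\<in>W. ((d, c) \<in> E \<longrightarrow> d = a \<or> d = b) \<and>
        (d \<noteq> a \<and> d \<noteq> b \<or> (d, c) \<in> E)"
      by (simp add: Pairing_def Let_def sat_QAll)
    from bspec[OF bspec[OF this that(1)] that(2)]
    obtain c where "c \<in> W" "\<forall>d\<in>W. ((d, c) \<in> E \<longrightarrow> d = a \<or> d = b) \<and>
        (d \<noteq> a \<and> d \<noteq> b \<or> (d, c) \<in> E)" ..
    then show ?thesis by (intro bexI[of _ c] ballI) auto
  qed
  have Union: "\<exists>c\<in>W. \<forall>d\<in>W. (d, c) \<in> E \<longleftrightarrow> (\<exists>b\<in>W. (b, a) \<in> E \<and> (d, b) \<in> E)" if "a \<in> W" for a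
  proof -
    have "sat W E ?v Unions" by (rule ax) (simp add: ZFC_def)
    then have "\<forall>a\<in>W. \<exists>c\<in>W. \<forall>d\<in>W. ((d, c) \<in> E \<longrightarrow> (\<exists>b\<in>W. (b, a) \<in> E \<and> (d, b) \<in> E)) \<and>
        ((\<forall>b\<in>W. (b, a) \<in> E \<longrightarrow> (d, b) \<notin> E) \<or> (d, c) \<in> E)"
      by (simp add: Unions_def Let_def sat_QAll)
    from bspec[OF this that]
    obtain c where "c \<in> W" "\<forall>d\<in>W. ((d, c) \<in> E \<longrightarrow> (\<exists>b\<in>W. (b, a) \<in> E \<and> (d, b) \<in> E)) \<and>
        ((\<forall>b\<in>W. (b, a) \<in> E \<longrightarrow> (d, b) \<notin> E) \<or> (d, c) \<in> E)" ..
    then show ?thesis by (intro bexI[of _ c] ballI) blast+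
  qed
  show ?thesis
  proof
    show "W \<noteq> {}" using e by blast
  next
    fix u v assume "u \<in> W" "v \<in> W" "members W E u = members W E v"
    then show "u = v" using Ext by (auto simp: members_def)
  next
    fix a assume "a \<in> W"
    then show "\<exists>w\<in>W. members W E w = {a}" using Pair[of a a] by (auto simp: members_def)
  next
    fix u v assume uv: "u \<in> W" "v \<in> W"
    then obtain p where p: "p \<in> W" "\<forall>d\<in>W. (d, p) \<in> E \<longleftrightarrow> d = u \<or> d = v" using Pair by blast
    then obtain c where "c \<in> W" "\<forall>d\<in>W. (d, c) \<in> E \<longleftrightarrow> (\<exists>b\<in>W. (b, p) \<in> E \<and> (d, b) \<in> E)"
      using Union by blast
    then show "\<exists>w\<in>W. members W E w = members W E u \<union> members W E v"
      using p uv by (intro bexI[of _ c]) (auto simp: members_def)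
  next
    fix u v assume uv: "u \<in> W" "v \<in> W"
    \<comment> \<open>The parameter \<open>v\<close> is stored at index 3, clear of the indices 0,
      1, 2 bound by the scheme.\<close>
    then have "range (?v(3 := v)) \<subseteq> W" using e by auto
    from models_Separation[OF M _ this uv(1), of "\<^bold>\<not> (0 \<^bold>\<in> 3)"]
    obtain b where "b \<in> W" "\<forall>x\<in>W. (x, b) \<in> E \<longleftrightarrow> (x, u) \<in> E \<and> (x, v) \<notin> E" by auto
    then show "\<exists>w\<in>W. members W E w = members W E u - members W E v"
      by (intro bexI[of _ b]) (auto simp: members_def)
  next
    fix u assume u: "u \<in> W"
    \<comment> \<open>Russell's argument: were \<open>u\<close> universal, the set \<open>b\<close>
      of its members that are not members of themselves would be a member of itself exactly if it
      were not.\<close>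
    from models_Separation[OF M _ v u, of "\<^bold>\<not> (0 \<^bold>\<in> 0)"]
    obtain b where "b \<in> W" "\<forall>x\<in>W. (x, b) \<in> E \<longleftrightarrow> (x, u) \<in> E \<and> (x, x) \<notin> E" by auto
    then show "members W E u \<noteq> W" by (auto simp: members_def)
  qed
qed


section \<open>Realising the splitting types\<close>

definition Sub :: "nat \<Rightarrow> nat \<Rightarrow> fm"
  where "Sub i j = FAll (0 \<^bold>\<in> Suc i \<^bold>\<longrightarrow> 0 \<^bold>\<in> Suc j)"

definition Disj :: "nat \<Rightarrow> nat \<Rightarrow> fm"
  where "Disj i j = FAll (0 \<^bold>\<in> Suc i \<^bold>\<longrightarrow> \<^bold>\<not> (0 \<^bold>\<in> Suc j))"

text \<open>A set has at least \<open>m\<close> members iff there is a strictly descending chain of \<open>m\<close> further sets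
  below it; this avoids naming the members.\<close>

primrec Big :: "nat \<Rightarrow> nat \<Rightarrow> fm" where
  "Big 0 i = \<^bold>\<not> \<^bold>\<bottom>"
| "Big (Suc m) i = \<^bold>\<not> FAll (\<^bold>\<not> (Sub 0 (Suc i) \<^bold>\<and> \<^bold>\<not> Sub (Suc i) 0 \<^bold>\<and> Big m 0))"

lemma fv_Sub: "fv (Sub i j) = {i, j}"
  by (auto simp: Sub_def)

lemma fv_Disj: "fv (Disj i j) = {i, j}"
  by (auto simp: Disj_def)

lemma fv_Big: "fv (Big m i) \<subseteq> {i}"
  by (induction m arbitrary: i) (auto simp: fv_Sub)

lemma sat_Sub: "sat W E v (Sub i j) \<longleftrightarrow> members W E (v i) \<subseteq> members W E (v j)"
  by (auto simp: Sub_def members_def)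

lemma sat_Disj: "sat W E v (Disj i j) \<longleftrightarrow> members W E (v i) \<inter> members W E (v j) = {}"
  by (auto simp: Disj_def members_def)

text \<open>A proper subset of a finite set is smaller. Conversely, deleting one point lowers a
  finite size by exactly one and keeps an infinite set infinite, and the result is again a member
  set.\<close>

lemma (in set_model) sat_Big:
  "v i \<in> W \<Longrightarrow> sat W E v (Big m i) \<longleftrightarrow> infinite (members W E (v i)) \<or> m \<le> card (members W E (v i))"
proof (induction m arbitrary: v i)
  case (Suc m)
  let ?X = "members W E (v i)"
  have "sat W E v (Big (Suc m) i) \<longleftrightarrow>
      (\<exists>y\<in>W. members W E y \<subset> ?X \<and> (infinite (members W E y) \<or> m \<le> card (members W E y)))"
    using Suc.IH by (auto simp: sat_Sub)
  also have "\<dots> \<longleftrightarrow> infinite ?X \<or> Suc m \<le> card ?X"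
  proof
    assume "\<exists>y\<in>W. members W E y \<subset> ?X \<and> (infinite (members W E y) \<or> m \<le> card (members W E y))"
    then obtain y where y: "members W E y \<subset> ?X" "infinite (members W E y) \<or> m \<le> card (members W E y)"
      by blast
    show "infinite ?X \<or> Suc m \<le> card ?X"
    proof (cases "finite ?X")
      case True
      then show ?thesis using y psubset_card_mono[OF True y(1)] finite_subset[of _ ?X] by auto
    qed simp
  next
    assume X: "infinite ?X \<or> Suc m \<le> card ?X"
    then obtain a where a: "a \<in> ?X" by (cases "?X = {}") auto
    then obtain s where "s \<in> W" "members W E s = {a}" using ex_singleton by (auto simp: members_def)
    then obtain y where y: "y \<in> W" "members W E y = ?X - {a}" using ex_diff[OF Suc.prems] by metis
    moreover have "infinite (?X - {a}) \<or> m \<le> card (?X - {a})"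
      using X a by (cases "finite ?X") auto
    ultimately show "\<exists>y\<in>W. members W E y \<subset> ?X \<and> (infinite (members W E y) \<or> m \<le> card (members W E y))"
      using a by (intro bexI[of _ y]) auto
  qed
  finally show ?case .
qed simp

lemma (in set_model) infinite_if_sat_Big:
  "v i \<in> W \<Longrightarrow> (\<And>m. sat W E v (Big m i)) \<Longrightarrow> infinite (members W E (v i))"
  using sat_Big[of v i "Suc (card (members W E (v i)))"] by (auto simp del: Big.simps)

text \<open>Compactness for types: each finite stage is satisfied in one model by a valuation that
  agrees with \<open>r\<close> on the variables of \<open>\<Gamma>\<close>, so the formulas of
  \<open>\<Gamma>\<close> stay true.\<close>

lemma consistent_Un_type:
  fixes \<Phi> :: "nat \<Rightarrow> fm set"
  assumes \<Gamma>: "\<And>p. p \<in> \<Gamma> \<Longrightarrow> sat W E r p" and "mono \<Phi>"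
    and \<Phi>: "\<And>n. \<exists>v. range v \<subseteq> W \<and> (\<forall>k\<in>Fv \<Gamma>. v k = r k) \<and> (\<forall>p\<in>\<Phi> n. sat W E v p)"
  shows "consistent (\<Gamma> \<union> (\<Union>n. \<Phi> n))"
proof -
  have "consistent (\<Gamma> \<union> \<Phi> n)" for n
  proof -
    obtain v where v: "range v \<subseteq> W" "\<forall>k\<in>Fv \<Gamma>. v k = r k" "\<forall>p\<in>\<Phi> n. sat W E v p"
      using \<Phi> by blast
    have "sat W E v p" if "p \<in> \<Gamma>" for p
      using \<Gamma>[OF that] sat_cong[of p v r W E] v(2) that by blast
    then show ?thesis using v by (intro consistent_if_sat[of v W _ E]) auto
  qed
  moreover have "mono (\<lambda>n. \<Gamma> \<union> \<Phi> n)" using assms(2) by (auto simp: mono_def)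
  ultimately have "consistent (\<Union>n. \<Gamma> \<union> \<Phi> n)" using consistent_Union_chain[of "\<lambda>n. \<Gamma> \<union> \<Phi> n"] by blast
  then show ?thesis by (simp add: UN_simps)
qed

section \<open>Countable models whose member sets form a splitting field\<close>

locale set_theory =
  fixes T :: "fm set"
  assumes T: "is_theory T" and ext: "extends T ZFC"
begin

lemma models_T:
  assumes "range r \<subseteq> W" and "\<And>p. p \<in> T \<Longrightarrow> sat W E r p"
  shows "models W E T"
proof -
  have "sat W E v p" if "p \<in> T" for v p
    using assms(2)[OF that] T that sat_cong[of p v r] by (auto simp: is_theory_def sentence_def)
  then show ?thesis using assms(1) by (auto simp: models_def)
qed

text \<open>The Henkin construction with trivial requirements. It supplies, at an intermediate
  stage, a model in which finite satisfiability of a type can be tested.\<close>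

lemma ex_set_model:
  assumes "T \<subseteq> \<Gamma>" and "consistent \<Gamma>" and "finite (Fv \<Gamma>)"
  shows "\<exists>(W :: nat set) E r. range r = W \<and> (\<forall>p\<in>\<Gamma>. sat W E r p) \<and> set_model W E"
proof -
  obtain W :: "nat set" and E r where *: "range r = W" "\<And>p. p \<in> \<Gamma> \<Longrightarrow> sat W E r p"
    by (rule henkin_model[OF assms(2,3), of "\<lambda>_ _. True"]) blast+
  then have "models W E T" using assms(1) by (intro models_T[of r]) auto
  then have "set_model W E" using ext by (intro set_model_if_models_ZFC models_ZFC_if_extends)
  then show ?thesis using * by blast
qed

text \<open>Infinity is not a single formula here: either one formula bounds the size of
  \<open>u\<close>, or the full types of two disjoint infinite subsets are present. Two disjoint
  subsets do the work of a subset and its difference.\<close>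

definition splits :: "nat \<Rightarrow> fm set \<Rightarrow> bool" where
  "splits u \<Gamma> \<longleftrightarrow> (\<exists>m. \<^bold>\<not> Big m u \<in> \<Gamma>) \<or>
    (\<exists>x y. {Sub x u, Sub y u, Disj x y} \<subseteq> \<Gamma> \<and> (\<forall>m. Big m x \<in> \<Gamma> \<and> Big m y \<in> \<Gamma>))"

definition avoids :: "nat \<Rightarrow> fm set \<Rightarrow> bool" where
  "avoids u \<Gamma> \<longleftrightarrow> (\<exists>z. Disj u z \<in> \<Gamma> \<and> (\<forall>m. Big m z \<in> \<Gamma>))"

text \<open>A model of \<open>\<Gamma>\<close> determines the alternative: a finite \<open>u\<close>
  is recorded with its bound, and for an infinite \<open>u\<close> the type is added in fresh
  variables \<open>x\<close> and \<open>y\<close>.\<close>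

lemma splits_step:
  assumes \<Gamma>: "T \<subseteq> \<Gamma>" "consistent \<Gamma>" "finite (Fv \<Gamma>)"
  shows "\<exists>\<Delta>. \<Gamma> \<subseteq> \<Delta> \<and> consistent \<Delta> \<and> finite (Fv \<Delta>) \<and> splits u \<Delta>"
proof -
  obtain W :: "nat set" and E r where r: "range r = W" and sat: "\<And>p. p \<in> \<Gamma> \<Longrightarrow> sat W E r p"
    and "set_model W E"
    using ex_set_model[OF \<Gamma>] by metis
  interpret set_model W E by fact
  have rW: "r k \<in> W" for k using r by auto
  show ?thesis
  proof (cases "finite (members W E (r u))")
    case True
    let ?p = "\<^bold>\<not> Big (Suc (card (members W E (r u)))) u"
    have "sat W E r ?p" using sat_Big[where v = r, OF rW] True by (simp del: Big.simps)
    then have "consistent (insert ?p \<Gamma>)" using sat r by (intro consistent_if_sat[of r W _ E]) auto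
    then show ?thesis using \<Gamma>(3)
      by (intro exI[of _ "insert ?p \<Gamma>"]) (auto simp: splits_def finite_fv simp del: Big.simps)
  next
    case False
    have "\<exists>x. x \<notin> Fv \<Gamma> \<union> {u}" using \<Gamma>(3) by (intro ex_new_if_finite) auto
    then obtain x where x: "x \<notin> Fv \<Gamma>" "x \<noteq> u" by blast
    have "\<exists>y. y \<notin> Fv \<Gamma> \<union> {u, x}" using \<Gamma>(3) by (intro ex_new_if_finite) auto
    then obtain y where y: "y \<notin> Fv \<Gamma>" "y \<noteq> u" "y \<noteq> x" by blast
    let ?\<Phi> = "\<lambda>n. {Sub x u, Sub y u, Disj x y} \<union> (\<lambda>m. Big m x) ` {..n} \<union> (\<lambda>m. Big m y) ` {..n}"
    let ?\<Delta> = "\<Gamma> \<union> (\<Union>n. ?\<Phi> n)"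
    have "consistent ?\<Delta>"
    proof (rule consistent_Un_type[of _ W E r])
      fix n
      obtain A where A: "finite A" "card A = n" "A \<subseteq> members W E (r u)"
        using infinite_arbitrarily_large[OF False] by blast
      obtain B where B: "finite B" "card B = n" "B \<subseteq> members W E (r u) - A"
        using infinite_arbitrarily_large[of "members W E (r u) - A"] False A(1) by auto
      have "A \<subseteq> W" "B \<subseteq> W" using A B by (auto simp: members_def)
      then obtain a b where ab: "a \<in> W" "members W E a = A" "b \<in> W" "members W E b = B"
        using ex_finite A B by meson
      let ?v = "r(x := a, y := b)"
      have v: "?v x = a" "?v y = b" "?v u = r u" using x y by auto
      have "range ?v \<subseteq> W" using ab rW by auto
      moreover have "\<forall>k\<in>Fv \<Gamma>. ?v k = r k" using x y by auto
      moreover have "\<forall>p\<in>?\<Phi> n. sat W E ?v p"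
        using A B ab v sat_Big[of ?v x] sat_Big[of ?v y]
        by (auto simp: sat_Sub sat_Disj simp del: fun_upd_apply)
      ultimately show "\<exists>v. range v \<subseteq> W \<and> (\<forall>k\<in>Fv \<Gamma>. v k = r k) \<and> (\<forall>p\<in>?\<Phi> n. sat W E v p)"
        by blast
    qed (use sat in \<open>auto intro!: monoI\<close>)
    moreover have "Fv ?\<Delta> \<subseteq> Fv \<Gamma> \<union> {x, y, u}" using fv_Big by (fastforce simp: fv_Sub fv_Disj)
    then have "finite (Fv ?\<Delta>)" using \<Gamma>(3) by (meson finite.emptyI finite.insertI finite_UnI finite_subset)
    moreover have "splits u ?\<Delta>"
      unfolding splits_def by (intro disjI2 exI[of _ x] exI[of _ y]) auto
    ultimately show ?thesis by (intro exI[of _ ?\<Delta>]) blast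
  qed
qed

lemma avoids_step:
  assumes \<Gamma>: "T \<subseteq> \<Gamma>" "consistent \<Gamma>" "finite (Fv \<Gamma>)"
  shows "\<exists>\<Delta>. \<Gamma> \<subseteq> \<Delta> \<and> consistent \<Delta> \<and> finite (Fv \<Delta>) \<and> avoids u \<Delta>"
proof -
  obtain W :: "nat set" and E r where r: "range r = W" and sat: "\<And>p. p \<in> \<Gamma> \<Longrightarrow> sat W E r p"
    and "set_model W E"
    using ex_set_model[OF \<Gamma>] by metis
  interpret set_model W E by fact
  have rW: "r k \<in> W" for k using r by auto
  have "\<exists>z. z \<notin> Fv \<Gamma> \<union> {u}" using \<Gamma>(3) by (intro ex_new_if_finite) auto
  then obtain z where z: "z \<notin> Fv \<Gamma>" "z \<noteq> u" by blast
  let ?\<Phi> = "\<lambda>n. {Disj u z} \<union> (\<lambda>m. Big m z) ` {..n}"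
  let ?\<Delta> = "\<Gamma> \<union> (\<Union>n. ?\<Phi> n)"
  have "consistent ?\<Delta>"
  proof (rule consistent_Un_type[of _ W E r])
    fix n
    \<comment> \<open>As no member set is cofinite, \<open>n\<close> points can be found outside
      \<open>u\<close>.\<close>
    obtain C where C: "finite C" "card C = n" "C \<subseteq> W - members W E (r u)"
      using infinite_arbitrarily_large[OF infinite_nonmembers[OF rW]] by blast
    then have "C \<subseteq> W" by blast
    then obtain c where c: "c \<in> W" "members W E c = C" using ex_finite C by meson
    let ?v = "r(z := c)"
    have v: "?v z = c" "?v u = r u" using z by auto
    have "range ?v \<subseteq> W" using c rW by auto
    moreover have "\<forall>k\<in>Fv \<Gamma>. ?v k = r k" using z by auto
    moreover have "\<forall>p\<in>?\<Phi> n. sat W E ?v p"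
      using C c v sat_Big[of ?v z] by (auto simp: sat_Disj simp del: fun_upd_apply)
    ultimately show "\<exists>v. range v \<subseteq> W \<and> (\<forall>k\<in>Fv \<Gamma>. v k = r k) \<and> (\<forall>p\<in>?\<Phi> n. sat W E v p)"
      by blast
  qed (use sat in \<open>auto intro!: monoI\<close>)
  moreover have "Fv ?\<Delta> \<subseteq> Fv \<Gamma> \<union> {z, u}" using fv_Big by (fastforce simp: fv_Disj)
  then have "finite (Fv ?\<Delta>)" using \<Gamma>(3) by (meson finite.emptyI finite.insertI finite_UnI finite_subset)
  moreover have "avoids u ?\<Delta>" unfolding avoids_def by (intro exI[of _ z]) auto
  ultimately show ?thesis by (intro exI[of _ ?\<Delta>]) blast
qed

theorem ex_splitting_model:
  assumes con: "consistent T"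
  obtains W :: "nat set" and E
  where "E \<subseteq> W \<times> W" and "models W E T" and "set_model W E"
    and "splitting_field W (members W E ` W)"
proof -
  have Fv: "finite (Fv T)" using T by (simp add: is_theory_def sentence_def)
  have mono: "splits u \<Delta>'" if "splits u \<Delta>" "\<Delta> \<subseteq> \<Delta>'" for u \<Delta> \<Delta>'
    using that unfolding splits_def by (meson subsetD subset_trans)
  have mono': "avoids u \<Delta>'" if "avoids u \<Delta>" "\<Delta> \<subseteq> \<Delta>'" for u \<Delta> \<Delta>'
    using that unfolding avoids_def by blast
  obtain W :: "nat set" and E r where r: "range r = W" and E: "E \<subseteq> W \<times> W"
    and sat: "\<And>p. p \<in> T \<Longrightarrow> sat W E r p"
    and Q: "\<And>n. splits n {p. sat W E r p} \<and> avoids n {p. sat W E r p}"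
  \<comment> \<open>Requirement \<open>n\<close> concerns the variable \<open>n\<close>. Since every
    element of the model is the value of a variable, all elements are covered.\<close>
  proof (rule henkin_model[OF con Fv, of "\<lambda>n \<Delta>. splits n \<Delta> \<and> avoids n \<Delta>"])
    fix n \<Delta> assume \<Delta>: "T \<subseteq> \<Delta>" "consistent \<Delta>" "finite (Fv \<Delta>)"
    obtain \<Delta>1 where 1: "\<Delta> \<subseteq> \<Delta>1" "consistent \<Delta>1" "finite (Fv \<Delta>1)" "splits n \<Delta>1"
      using splits_step[OF \<Delta>] by blast
    then have "T \<subseteq> \<Delta>1" using \<Delta>(1) by blast
    then obtain \<Delta>2 where "\<Delta>1 \<subseteq> \<Delta>2" "consistent \<Delta>2" "finite (Fv \<Delta>2)" "avoids n \<Delta>2"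
      using avoids_step[OF _ 1(2,3)] by blast
    then show "\<exists>\<Delta>'. \<Delta> \<subseteq> \<Delta>' \<and> consistent \<Delta>' \<and> finite (Fv \<Delta>') \<and> splits n \<Delta>' \<and> avoids n \<Delta>'"
      using 1 mono by (intro exI[of _ \<Delta>2]) auto
  next
    fix n \<Delta> \<Delta>' assume "splits n \<Delta> \<and> avoids n \<Delta>" "\<Delta> \<subseteq> \<Delta>'"
    then show "splits n \<Delta>' \<and> avoids n \<Delta>'" using mono mono' by blast
  qed (rule that)
  have models: "models W E T" using r sat by (intro models_T[of r]) auto
  interpret set_model W E
    using models_ZFC_if_extends[OF models ext] by (rule set_model_if_models_ZFC)
  have rW: "r k \<in> W" for k using r by auto
  have "splitting_field W (members W E ` W)"
  proof
    show "X \<subseteq> W" if "X \<in> members W E ` W" for X using that by (auto simp: members_def)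
    show "X \<in> members W E ` W" if "finite X" "X \<subseteq> W" for X using ex_finite[OF that] by auto
    show "X \<union> Y \<in> members W E ` W" if "X \<in> members W E ` W" "Y \<in> members W E ` W" for X Y
      using that ex_union by (auto simp: image_iff) metis
    show "X - Y \<in> members W E ` W" if "X \<in> members W E ` W" "Y \<in> members W E ` W" for X Y
      using that ex_diff by (auto simp: image_iff) metis
    show "W \<notin> members W E ` W" using not_universal by (metis imageE)
  next
    fix X assume X: "X \<in> members W E ` W" "infinite X"
    then obtain u where u: "X = members W E (r u)" using r by auto
    have "sat W E r (Big m u)" for m using sat_Big[where v = r, OF rW] X u by auto
    then obtain x y where "sat W E r (Sub x u)" "sat W E r (Sub y u)" "sat W E r (Disj x y)"
        "\<And>m. sat W E r (Big m x)" "\<And>m. sat W E r (Big m y)"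
      using Q[of u] unfolding splits_def by auto
    then have *: "members W E (r x) \<subseteq> X" "members W E (r y) \<subseteq> X"
        "members W E (r x) \<inter> members W E (r y) = {}"
        "infinite (members W E (r x))" "infinite (members W E (r y))"
      using infinite_if_sat_Big[where v = r, OF rW] by (auto simp: u sat_Sub sat_Disj)
    \<comment> \<open>The remainder contains the second infinite subset, that of
      \<open>r y\<close>.\<close>
    then have "infinite (X - members W E (r x))"
      using finite_subset[of "members W E (r y)" "X - members W E (r x)"] by blast
    then show "\<exists>Y\<in>members W E ` W. Y \<subseteq> X \<and> infinite Y \<and> infinite (X - Y)" using * rW by blast
  next
    fix X assume "X \<in> members W E ` W"
    then obtain u where u: "X = members W E (r u)" using r by auto
    obtain z where "sat W E r (Disj u z)" "\<And>m. sat W E r (Big m z)"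
      using Q[of u] unfolding avoids_def by auto
    then have "X \<inter> members W E (r z) = {}" "infinite (members W E (r z))"
      using infinite_if_sat_Big[where v = r, OF rW] by (auto simp: u sat_Disj)
    then show "\<exists>Y\<in>members W E ` W. X \<inter> Y = {} \<and> infinite Y" using rW by blast
  qed
  then show thesis using that E models set_model_axioms by blast
qed

end

section \<open>Transport to a common domain\<close>

lemma sat_transfer:
  assumes "bij_betw h W W'" and "range v \<subseteq> W"
  shows "sat W {(a, b). a \<in> W \<and> b \<in> W \<and> (h a, h b) \<in> E'} v p \<longleftrightarrow> sat W' E' (\<lambda>k. h (v k)) p"
  using assms(2)
proof (induction p arbitrary: v)
  case (FAll p)
  have "sat W {(a, b). a \<in> W \<and> b \<in> W \<and> (h a, h b) \<in> E'} (case_nat a v) p \<longleftrightarrow>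
      sat W' E' (case_nat (h a) (\<lambda>k. h (v k))) p" if "a \<in> W" for a
  proof -
    have "range (case_nat a v) \<subseteq> W" using FAll.prems that by (force split: nat.split)
    moreover have "(\<lambda>k. h (case_nat a v k)) = case_nat (h a) (\<lambda>k. h (v k))"
      by (rule ext) (simp split: nat.split)
    ultimately show ?thesis using FAll.IH by simp
  qed
  \<comment> \<open>Surjectivity of \<open>h\<close> makes both quantifiers range over corresponding
    elements; injectivity is what the equality case uses.\<close>
  moreover have "W' = h ` W" using assms(1) by (simp add: bij_betw_def)
  ultimately show ?case by simp
next
  case (Eql i j)
  then have "v i \<in> W" "v j \<in> W" by auto
  then show ?case using assms(1) by (auto simp: bij_betw_def dest: inj_onD)
next
  case (Mem i j)
  then have "v i \<in> W" "v j \<in> W" by auto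
  then show ?case by simp
qed auto

theorem theorem3p1:
  fixes T T' :: "fm set"
  assumes "is_theory T" and "is_theory T'"
    and "consistent T" and "consistent T'"
    and "extends T ZFC" and "extends T' ZFC"
  shows "\<exists>(W :: nat set) (E :: nat rel) (E' :: nat rel).
    E \<subseteq> W \<times> W \<and> E' \<subseteq> W \<times> W \<and>
    models W E T \<and> models W E' T' \<and>
    (\<forall>u\<in>W. \<forall>v\<in>W.
      (\<forall>a\<in>W. (a, u) \<in> E \<longrightarrow> (a, v) \<in> E) \<longleftrightarrow> (\<forall>a\<in>W. (a, u) \<in> E' \<longrightarrow> (a, v) \<in> E'))"
proof -
  obtain W :: "nat set" and E where E: "E \<subseteq> W \<times> W" and M: "models W E T" "set_model W E"
    and F: "splitting_field W (members W E ` W)"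
    using set_theory.ex_splitting_model[of T] assms by (metis set_theory.intro)
  obtain W' :: "nat set" and E' where M': "models W' E' T'" "set_model W' E'"
    and F': "splitting_field W' (members W' E' ` W')"
    using set_theory.ex_splitting_model[of T'] assms by (metis set_theory.intro)
  let ?m = "members W E" and ?m' = "members W' E'"
  \<comment> \<open>By extensionality, elements correspond one-to-one to their member sets, so an
    isomorphism of the fields induces a bijection of the domains.\<close>
  have bij: "bij_betw ?m W (?m ` W)" "bij_betw ?m' W' (?m' ` W')"
    using set_model.extensional[OF M(2)] set_model.extensional[OF M'(2)]
    by (auto simp: bij_betw_def inj_on_def)
  interpret two_splitting_fields W "?m ` W" W' "?m' ` W'"
    using F F' by (rule two_splitting_fields.intro)
  obtain g where g: "bij_betw g (?m ` W) (?m' ` W')"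
    and g_mono: "\<And>X Y. X \<in> ?m ` W \<Longrightarrow> Y \<in> ?m ` W \<Longrightarrow> X \<subseteq> Y \<longleftrightarrow> g X \<subseteq> g Y"
    by (rule inclusion_isomorphic) auto
  define h where "h = inv_into W' ?m' \<circ> g \<circ> ?m"
  have h: "bij_betw h W W'"
    unfolding h_def
    by (intro bij_betw_trans[OF bij_betw_trans[OF bij(1) g] bij_betw_inv_into[OF bij(2)],
          unfolded comp_assoc[symmetric]])
  have m'_h: "?m' (h u) = g (?m u)" if "u \<in> W" for u
    using that g f_inv_into_f[of "g (?m u)" ?m' W'] by (auto simp: h_def bij_betw_def)
  \<comment> \<open>The second membership relation pulled back along \<open>h\<close>, which makes
    \<open>h\<close> an isomorphism onto the second model.\<close>
  let ?E = "{(a, b). a \<in> W \<and> b \<in> W \<and> (h a, h b) \<in> E'}"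
  have hW: "h ` W = W'" using h by (simp add: bij_betw_def)
  have "models W ?E T'"
    unfolding models_def
  proof (intro conjI ballI allI impI)
    show "W \<noteq> {}" using M(1) by (simp add: models_def)
    fix p and v :: "nat \<Rightarrow> nat" assume p: "p \<in> T'" and v: "range v \<subseteq> W"
    have "range (\<lambda>k. h (v k)) \<subseteq> W'" using v hW by auto
    then have "sat W' E' (\<lambda>k. h (v k)) p" using M'(1) p unfolding models_def by blast
    then show "sat W ?E v p" using sat_transfer[OF h v] by blast
  qed
  moreover have "(\<forall>a\<in>W. (a, u) \<in> E \<longrightarrow> (a, v) \<in> E) \<longleftrightarrow> (\<forall>a\<in>W. (a, u) \<in> ?E \<longrightarrow> (a, v) \<in> ?E)"
    if "u \<in> W" "v \<in> W" for u v
  proof -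
    have "(\<forall>a\<in>W. (a, u) \<in> E \<longrightarrow> (a, v) \<in> E) \<longleftrightarrow> ?m u \<subseteq> ?m v" by (auto simp: members_def)
    also have "\<dots> \<longleftrightarrow> ?m' (h u) \<subseteq> ?m' (h v)" using g_mono that by (simp add: m'_h)
    also have "\<dots> \<longleftrightarrow> (\<forall>a\<in>W. (a, u) \<in> ?E \<longrightarrow> (a, v) \<in> ?E)"
      \<comment> \<open>As \<open>h\<close> maps onto \<open>W'\<close>, testing all
        \<open>a\<close> in \<open>W\<close> tests all possible members of
        \<open>h u\<close>.\<close>
      using that by (auto simp: members_def hW[symmetric])
    finally show ?thesis .
  qed
  ultimately show ?thesis
    using E M(1) by (intro exI[of _ W] exI[of _ E] exI[of _ ?E] conjI ballI) auto
qed

end
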